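(* Let $X_1,\ldots,X_n$ be independent random variables and let $Z=Z(X_1,\ldots,X_n)$ be a real-valued random variable that is a function of them. For each $k\in\{1,\ldots,n\}$ put $$Z_k^{(M)}:=\inf_{x_k}Z(X_1,\ldots,X_{k-1},x_k,X_{k+1},\ldots,X_n),\qquad Z_k^{(L)}:=\sup_{x_k}Z(X_1,\ldots,X_{k-1},x_k,X_{k+1},\ldots,X_n),$$ where the infimum runs over all the possible values $x_k$ which $X_k$ can take, or over a compact set containing the support of the distribution of $X_k$, and the supremum runs over a compact set containing the support of the distribution of $X_k$. Put $$\Delta_M^2:=\sum_{k=1}^n\bigl(Z-Z_k^{(M)}\bigr)^2,\qquad \Delta_L^2:=\sum_{k=1}^n\bigl(Z-Z_k^{(L)}\bigr)^2 .$$ (i) If $\|\Delta_M^2\|_\infty<\infty$, then for every $t\ge 0$, $$P(Z-EZ\ge t)\le\exp\left(-\frac{t^2}{2\|\Delta_M^2\|_\infty}\right).$$ (ii) If $\|\Delta_L^2\|_\infty<\infty$, then for every $t\ge 0$, $$P(Z-EZ\le -t)\le\exp\left(-\frac{t^2}{2\|\Delta_L^2\|_\infty}\right).$$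
   Context: The $X_k$ may be vector-valued (for instance, with values in $\mathbb{C}^m$). The function $Z$ is understood to be measurable and defined at all the points over which the infima and suprema are taken, and $Z_k^{(M)}$, $Z_k^{(L)}$ are random variables depending only on the $X_j$ with $j\ne k$. $\|\cdot\|_\infty$ denotes the essential supremum norm of a random variable, and $E$ denotes expectation over $X_1,\ldots,X_n$. *)

theory Defs
  imports "HOL-Probability.Probability"
begin

(* Extensional tuples, so that the values are points of the product space PiM {1..n} borel. *)
definition joint :: "nat \<Rightarrow> (nat \<Rightarrow> 'w \<Rightarrow> 'a) \<Rightarrow> 'w \<Rightarrow> nat \<Rightarrow> 'a" where
  "joint n X \<omega> = (\<lambda>i\<in>{1..n}. X i \<omega>)"

(* The sigma-algebra on the sample space generated by the X j with j in {1..n}, j \<noteq> k. *)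
definition sigma_others ::
  "'w measure \<Rightarrow> nat \<Rightarrow> (nat \<Rightarrow> 'w \<Rightarrow> 'a::topological_space) \<Rightarrow> nat \<Rightarrow> 'w measure" where
  "sigma_others M n X k =
     vimage_algebra (space M) (\<lambda>\<omega>. \<lambda>i\<in>{1..n} - {k}. X i \<omega>) (\<Pi>\<^sub>M i\<in>{1..n} - {k}. borel)"

definition measure_support :: "'a::topological_space measure \<Rightarrow> 'a set" where
  "measure_support \<mu> = {x. \<forall>U. open U \<longrightarrow> x \<in> U \<longrightarrow> emeasure \<mu> U > 0}"

definition compact_range ::
  "'w measure \<Rightarrow> ('w \<Rightarrow> 'a::topological_space) \<Rightarrow> 'a set \<Rightarrow> bool" where
  "compact_range M Y S \<longleftrightarrow> compact S \<and> measure_support (distr M borel Y) \<subseteq> S"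

(* Extended-real values: on the reals, INF and SUP over an unbounded set are unspecified. *)
definition Z_inf ::
  "nat \<Rightarrow> (nat \<Rightarrow> 'w \<Rightarrow> 'a) \<Rightarrow> ((nat \<Rightarrow> 'a) \<Rightarrow> real) \<Rightarrow> (nat \<Rightarrow> 'a set) \<Rightarrow> nat \<Rightarrow> 'w \<Rightarrow> ereal" where
  "Z_inf n X Z S k \<omega> = (INF x\<in>S k. ereal (Z ((joint n X \<omega>)(k := x))))"

definition Z_sup ::
  "nat \<Rightarrow> (nat \<Rightarrow> 'w \<Rightarrow> 'a) \<Rightarrow> ((nat \<Rightarrow> 'a) \<Rightarrow> real) \<Rightarrow> (nat \<Rightarrow> 'a set) \<Rightarrow> nat \<Rightarrow> 'w \<Rightarrow> ereal" where
  "Z_sup n X Z S k \<omega> = (SUP x\<in>S k. ereal (Z ((joint n X \<omega>)(k := x))))"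

definition Delta_M_sq ::
  "nat \<Rightarrow> (nat \<Rightarrow> 'w \<Rightarrow> 'a) \<Rightarrow> ((nat \<Rightarrow> 'a) \<Rightarrow> real) \<Rightarrow> (nat \<Rightarrow> 'a set) \<Rightarrow> 'w \<Rightarrow> ereal" where
  "Delta_M_sq n X Z S \<omega> = (\<Sum>k=1..n. (ereal (Z (joint n X \<omega>)) - Z_inf n X Z S k \<omega>)\<^sup>2)"

definition Delta_L_sq ::
  "nat \<Rightarrow> (nat \<Rightarrow> 'w \<Rightarrow> 'a) \<Rightarrow> ((nat \<Rightarrow> 'a) \<Rightarrow> real) \<Rightarrow> (nat \<Rightarrow> 'a set) \<Rightarrow> 'w \<Rightarrow> ereal" where
  "Delta_L_sq n X Z S \<omega> = (\<Sum>k=1..n. (ereal (Z (joint n X \<omega>)) - Z_sup n X Z S k \<omega>)\<^sup>2)"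

definition Linf_norm :: "'w measure \<Rightarrow> ('w \<Rightarrow> ereal) \<Rightarrow> ereal" where
  "Linf_norm M f = esssup M (\<lambda>\<omega>. \<bar>f \<omega>\<bar>)"

(* The extended exponential makes exp (- t^2 / (2 V)) meaningful for V = 0: ereal division gives
   t^2 / 0 = \<infinity> for t \<noteq> 0, hence the bound 0, and 0 / 0 = 0, hence the trivial bound 1 for t = 0.
   Real division would instead give t^2 / 0 = 0 and so the trivial bound for every t. *)
definition exp_ereal :: "ereal \<Rightarrow> ereal" where
  "exp_ereal x = (if x = \<infinity> then \<infinity> else if x = - \<infinity> then 0 else ereal (exp (real_of_ereal x)))"

lemma exp_ereal_simps [simp]:
  "exp_ereal (ereal r) = ereal (exp r)" "exp_ereal \<infinity> = \<infinity>" "exp_ereal (- \<infinity>) = 0"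
  by (simp_all add: exp_ereal_def)

lemma exp_ereal_bound_pos:
  assumes "V > 0"
  shows "exp_ereal (- (ereal (t\<^sup>2) / (2 * ereal V))) = ereal (exp (- (t\<^sup>2 / (2 * V))))"
proof -
  have "2 * ereal V = ereal (2 * V)" by simp
  then show ?thesis using assms by simp
qed

lemma exp_ereal_bound_zero:
  "exp_ereal (- (ereal (t\<^sup>2) / (2 * 0))) = (if t = 0 then 1 else 0)"
  by (auto simp: exp_ereal_def divide_ereal_def zero_ereal_def[symmetric])

end

(* Entropy method. On the product space, telescoping the logarithm of the partial averages of exp (l Z)
   over the coordinates bounds the entropy of exp (l Z) by a sum of one-coordinate terms, in which any
   function not depending on that coordinate may be used as a reference value. Taking exp (l Z_k) with Z_k
   the infimum over the k-th coordinate, and s - 1 + exp (- s) <= s^2 / 2 for s >= 0, gives the bound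
   l^2 V / 2 * E exp (l Z), which Herbst's argument integrates to a sub-Gaussian moment generating function.
   Integrability is not assumed: since Z exceeds its value after resampling a coordinate by at most sqrt V,
   Z is almost surely bounded. The lower tail is the upper tail of - Z. *)
theory Submission
  imports Defs
begin

subsection \<open>Bounded measurable functions\<close>

text \<open>The infimum as a function on the product space need not be measurable, so the reference
  value is obtained by factoring the random variable \<open>Z_inf n X Z S k\<close> through the
  other coordinates. The resulting \<open>g k\<close> ignores the k-th coordinate at every point, as
  the entropy bound requires, but agrees with the infimum only almost surely. The infimum is
  essential for the sign: the quadratic bound on the exponential holds only for
  \<open>s \<ge> 0\<close>, so references below \<open>Z\<close> control the upper tail. Entropy
  estimates are made for functions bounded at every point, so that all sections stay bounded and all
  integrals exist; clamping brings an almost surely bounded \<open>Z\<close> into this class without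
  enlarging the differences \<open>Z - g k\<close>. Averaging over an independent copy serves as
  conditional expectation. A vanishing variance proxy is handled through the bounds for all positive
  proxies.\<close>

definition bounded_measurable :: "'a measure \<Rightarrow> ('a \<Rightarrow> real) set" where
  "bounded_measurable M = {f \<in> borel_measurable M. \<exists>B. \<forall>x\<in>space M. \<bar>f x\<bar> \<le> B}"

lemma bounded_measurableI:
  "f \<in> borel_measurable M \<Longrightarrow> (\<And>x. x \<in> space M \<Longrightarrow> \<bar>f x\<bar> \<le> B) \<Longrightarrow> f \<in> bounded_measurable M"
  by (auto simp: bounded_measurable_def)

lemma bounded_measurable_borel: "f \<in> bounded_measurable M \<Longrightarrow> f \<in> borel_measurable M"
  by (simp add: bounded_measurable_def)

lemma bounded_measurableD:
  assumes "f \<in> bounded_measurable M"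
  shows "\<exists>B>0. \<forall>x\<in>space M. \<bar>f x\<bar> \<le> B"
proof -
  obtain B where "\<forall>x\<in>space M. \<bar>f x\<bar> \<le> B"
    using assms by (auto simp: bounded_measurable_def)
  then show ?thesis
    by (intro exI[of _ "max B 1"]) (auto simp: le_max_iff_disj)
qed

lemma bounded_measurable_const: "(\<lambda>_. c) \<in> bounded_measurable M"
  by (auto simp: bounded_measurable_def)

lemma bounded_measurable_add:
  assumes "f \<in> bounded_measurable M" "g \<in> bounded_measurable M"
  shows "(\<lambda>x. f x + g x) \<in> bounded_measurable M"
proof -
  obtain B where "\<forall>x\<in>space M. \<bar>f x\<bar> \<le> B"
    using bounded_measurableD[OF assms(1)] by blast
  moreover obtain C where "\<forall>x\<in>space M. \<bar>g x\<bar> \<le> C"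
    using bounded_measurableD[OF assms(2)] by blast
  ultimately show ?thesis
    using assms[THEN bounded_measurable_borel]
    by (intro bounded_measurableI[where B = "B + C"]) (auto intro!: order_trans[OF abs_triangle_ineq] add_mono)
qed

lemma bounded_measurable_mult:
  assumes "f \<in> bounded_measurable M" "g \<in> bounded_measurable M"
  shows "(\<lambda>x. f x * g x) \<in> bounded_measurable M"
proof -
  obtain B where "\<forall>x\<in>space M. \<bar>f x\<bar> \<le> B" "0 < B"
    using bounded_measurableD[OF assms(1)] by blast
  moreover obtain C where "\<forall>x\<in>space M. \<bar>g x\<bar> \<le> C" "0 < C"
    using bounded_measurableD[OF assms(2)] by blast
  ultimately show ?thesis
    using assms[THEN bounded_measurable_borel]
    by (intro bounded_measurableI[where B = "B * C"]) (auto simp: abs_mult intro!: mult_mono)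
qed

lemma bounded_measurable_uminus:
  "f \<in> bounded_measurable M \<Longrightarrow> (\<lambda>x. - f x) \<in> bounded_measurable M"
  using bounded_measurable_mult[OF bounded_measurable_const[of "-1"]] by simp

lemma bounded_measurable_diff:
  "f \<in> bounded_measurable M \<Longrightarrow> g \<in> bounded_measurable M \<Longrightarrow> (\<lambda>x. f x - g x) \<in> bounded_measurable M"
  using bounded_measurable_add[OF _ bounded_measurable_uminus] by simp

lemma bounded_measurable_power:
  "f \<in> bounded_measurable M \<Longrightarrow> (\<lambda>x. f x ^ n) \<in> bounded_measurable M"
  by (induction n) (simp_all add: bounded_measurable_const bounded_measurable_mult)

lemma bounded_measurable_sum:
  "(\<And>i. i \<in> I \<Longrightarrow> f i \<in> bounded_measurable M) \<Longrightarrow> (\<lambda>x. \<Sum>i\<in>I. f i x) \<in> bounded_measurable M"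
  by (induction I rule: infinite_finite_induct)
    (simp_all add: bounded_measurable_const bounded_measurable_add)

lemma bounded_measurable_exp:
  assumes "f \<in> bounded_measurable M"
  shows "(\<lambda>x. exp (f x)) \<in> bounded_measurable M"
proof -
  obtain B where B: "\<forall>x\<in>space M. \<bar>f x\<bar> \<le> B"
    using bounded_measurableD[OF assms] by blast
  then show ?thesis
    using bounded_measurable_borel[OF assms]
    by (intro bounded_measurableI[where B = "exp B"]) (auto simp: abs_le_iff)
qed

lemma bounded_measurable_ln:
  assumes "f \<in> bounded_measurable M" "\<And>x. x \<in> space M \<Longrightarrow> a \<le> f x" "0 < a"
  shows "(\<lambda>x. ln (f x)) \<in> bounded_measurable M"
proof -
  obtain B where B: "\<forall>x\<in>space M. \<bar>f x\<bar> \<le> B"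
    using bounded_measurableD[OF assms(1)] by blast
  have "\<bar>ln (f x)\<bar> \<le> \<bar>ln a\<bar> + \<bar>ln B\<bar>" if x: "x \<in> space M" for x
  proof -
    have "ln a \<le> ln (f x)" "ln (f x) \<le> ln B"
      using bspec[OF B x] assms(2)[OF x] assms(3) by auto
    then show ?thesis
      by linarith
  qed
  then show ?thesis
    using bounded_measurable_borel[OF assms(1)] by (intro bounded_measurableI) auto
qed

lemma bounded_measurable_divide:
  fixes g :: "'a \<Rightarrow> real"
  assumes "f \<in> bounded_measurable M" "g \<in> bounded_measurable M" "\<And>x. x \<in> space M \<Longrightarrow> a \<le> g x" "0 < a"
  shows "(\<lambda>x. f x / g x) \<in> bounded_measurable M"
proof -
  have "(\<lambda>x. 1 / g x) \<in> bounded_measurable M"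
  proof (rule bounded_measurableI)
    show "(\<lambda>x. 1 / g x) \<in> borel_measurable M"
      using bounded_measurable_borel[OF assms(2)] by measurable
    fix x assume "x \<in> space M"
    then show "\<bar>1 / g x\<bar> \<le> 1 / a"
      using assms(3)[of x] assms(4) by (auto simp: field_simps)
  qed
  from bounded_measurable_mult[OF assms(1) this] show ?thesis
    by simp
qed

lemmas bounded_measurable_intros =
  bounded_measurable_const bounded_measurable_add bounded_measurable_mult bounded_measurable_diff
  bounded_measurable_power bounded_measurable_sum bounded_measurable_exp

lemma (in finite_measure) integrable_bounded_measurable:
  assumes "f \<in> bounded_measurable M"
  shows "integrable M f"
proof -
  obtain B where "\<forall>x\<in>space M. \<bar>f x\<bar> \<le> B"
    using bounded_measurableD[OF assms] by blast
  then show ?thesis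
    using bounded_measurable_borel[OF assms] by (intro integrable_const_bound[of _ B]) auto
qed

subsection \<open>The Herbst argument\<close>

text \<open>Right side minus left side vanishes at 0 and has derivative
  \<open>s - 1 + exp (- s) \<ge> 0\<close>. For negative \<open>s\<close> the inequality fails, so
  references have to lie below \<open>Z\<close>.\<close>

lemma exp_minus_le:
  fixes s :: real
  assumes "0 \<le> s"
  shows "exp (- s) \<le> 1 - s + s\<^sup>2 / 2"
proof -
  have "(\<lambda>s::real. s\<^sup>2 / 2 - s + 1 - exp (- s)) 0 \<le> (\<lambda>s. s\<^sup>2 / 2 - s + 1 - exp (- s)) s"
  proof (rule DERIV_nonneg_imp_nondecreasing[OF assms])
    fix x :: real
    have "((\<lambda>s. s\<^sup>2 / 2 - s + 1 - exp (- s)) has_real_derivative (x - 1 + exp (- x))) (at x)"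
      by (auto intro!: derivative_eq_intros)
    moreover have "0 \<le> x - 1 + exp (- x)"
      using exp_ge_add_one_self[of "- x"] by simp
    ultimately show "\<exists>y. ((\<lambda>s. s\<^sup>2 / 2 - s + 1 - exp (- s)) has_real_derivative y) (at x) \<and> 0 \<le> y"
      by blast
  qed
  then show ?thesis by simp
qed

text \<open>A quadratic remainder uniform in \<open>u\<close> allows the moment generating function
  to be differentiated by an estimate inside the expectation.\<close>

lemma abs_exp_minus_linear_le:
  fixes u :: real
  assumes "\<bar>u\<bar> \<le> 1"
  shows "\<bar>exp u - 1 - u\<bar> \<le> u\<^sup>2"
proof (cases "0 \<le> u")
  case True
  then show ?thesis
    using exp_bound[of u] assms exp_ge_add_one_self[of u] by linarith
next
  case False
  then have "exp u \<le> 1 + u + u\<^sup>2 / 2"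
    using exp_minus_le[of "- u"] by simp
  moreover have "u\<^sup>2 / 2 \<le> u\<^sup>2" by simp
  ultimately show ?thesis
    using exp_ge_add_one_self[of u] by linarith
qed

context prob_space
begin

lemma has_derivative_mgf:
  assumes Z: "Z \<in> bounded_measurable M"
  shows "((\<lambda>l. expectation (\<lambda>x. exp (l * Z x))) has_real_derivative
    expectation (\<lambda>x. Z x * exp (l * Z x))) (at l)"
proof -
  define F where "F l = expectation (\<lambda>x. exp (l * Z x))" for l
  define D where "D = expectation (\<lambda>x. Z x * exp (l * Z x))"
  obtain B where B0: "\<forall>x\<in>space M. \<bar>Z x\<bar> \<le> B" "0 < B"
    using bounded_measurableD[OF Z] by blast
  note B = B0(1)[rule_format] B0(2)
  \<comment> \<open>The exponential bounds \<open>exp (l * Z x)\<close> and \<open>B\<^sup>2\<close>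
    bounds \<open>(Z x)\<^sup>2\<close>. The restriction \<open>\<bar>h\<bar> \<le> 1 / B\<close>
    below keeps \<open>h * Z x\<close> within the range of the remainder estimate.\<close>
  define C where "C = exp (\<bar>l\<bar> * B) * B\<^sup>2"
  have int: "integrable M (\<lambda>x. exp (m * Z x))" "integrable M (\<lambda>x. Z x * exp (m * Z x))" for m
    by (intro integrable_bounded_measurable bounded_measurable_intros Z)+
  have bound: "\<bar>F (l + h) - F l - h * D\<bar> \<le> C * h\<^sup>2" if h: "\<bar>h\<bar> \<le> 1 / B" for h
  proof -
    have eq: "F (l + h) - F l - h * D =
      expectation (\<lambda>x. exp ((l + h) * Z x) - exp (l * Z x) - h * (Z x * exp (l * Z x)))"
      unfolding F_def D_def using int by simp
    have "\<bar>F (l + h) - F l - h * D\<bar> \<le>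
      expectation (\<lambda>x. \<bar>exp ((l + h) * Z x) - exp (l * Z x) - h * (Z x * exp (l * Z x))\<bar>)"
      unfolding eq by (rule integral_abs_bound)
    also have "\<dots> \<le> expectation (\<lambda>x. C * h\<^sup>2)"
    proof (rule integral_mono)
      show "integrable M (\<lambda>x. \<bar>exp ((l + h) * Z x) - exp (l * Z x) - h * (Z x * exp (l * Z x))\<bar>)"
        by (intro integrable_abs integrable_bounded_measurable bounded_measurable_intros Z)
      fix x assume x: "x \<in> space M"
      have "\<bar>h * Z x\<bar> \<le> (1 / B) * B"
        unfolding abs_mult by (intro mult_mono h B(1)[OF x]) (use B(2) in auto)
      then have hz: "\<bar>h * Z x\<bar> \<le> 1"
        using B(2) by simp
      have eq: "exp ((l + h) * Z x) - exp (l * Z x) - h * (Z x * exp (l * Z x)) =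
        exp (l * Z x) * (exp (h * Z x) - 1 - h * Z x)"
        by (simp add: distrib_right exp_add) (simp add: algebra_simps)
      have "\<bar>exp ((l + h) * Z x) - exp (l * Z x) - h * (Z x * exp (l * Z x))\<bar> = exp (l * Z x) * \<bar>exp (h * Z x) - 1 - h * Z x\<bar>"
        unfolding eq by (simp add: abs_mult)
      also have "\<dots> \<le> exp (\<bar>l\<bar> * B) * (h * Z x)\<^sup>2"
      proof (intro mult_mono abs_exp_minus_linear_le hz)
        have "l * Z x \<le> \<bar>l\<bar> * \<bar>Z x\<bar>"
          by (metis abs_ge_self abs_mult)
        also have "\<dots> \<le> \<bar>l\<bar> * B"
          by (intro mult_left_mono B(1)[OF x]) auto
        finally show "exp (l * Z x) \<le> exp (\<bar>l\<bar> * B)" by simp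
      qed auto
      also have "\<dots> \<le> exp (\<bar>l\<bar> * B) * (h\<^sup>2 * B\<^sup>2)"
        using power_mono[OF B(1)[OF x], of 2]
        by (auto simp: power_mult_distrib intro!: mult_left_mono)
      also have "\<dots> = C * h\<^sup>2"
        by (simp add: C_def)
      finally show "\<bar>exp ((l + h) * Z x) - exp (l * Z x) - h * (Z x * exp (l * Z x))\<bar> \<le> C * h\<^sup>2" .
    qed simp
    finally show ?thesis
      by (simp add: prob_space)
  qed
  have "((\<lambda>h. (F (l + h) - F l) / h) \<longlongrightarrow> D) (at 0)"
  proof (rule LIM_zero_cancel, rule Lim_null_comparison)
    have "eventually (\<lambda>h. \<bar>h\<bar> < 1 / B \<and> h \<noteq> 0) (at 0)"
      using B(2) by (auto simp: eventually_at intro!: exI[of _ "1 / B"])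
    then show "eventually (\<lambda>h. norm ((F (l + h) - F l) / h - D) \<le> C * \<bar>h\<bar>) (at 0)"
    proof eventually_elim
      case (elim h)
      then have "(F (l + h) - F l) / h - D = (F (l + h) - F l - h * D) / h"
        by (simp add: diff_divide_distrib)
      then have "\<bar>(F (l + h) - F l) / h - D\<bar> = \<bar>F (l + h) - F l - h * D\<bar> / \<bar>h\<bar>"
        by simp
      also have "\<dots> \<le> C * h\<^sup>2 / \<bar>h\<bar>"
        using bound[of h] elim by (intro divide_right_mono) auto
      also have "\<dots> = C * \<bar>h\<bar>"
        using elim by (simp add: power2_eq_square abs_if)
      finally show ?case
        by simp
    qed
    show "((\<lambda>h. C * \<bar>h\<bar>) \<longlongrightarrow> 0) (at 0)"
      by (auto intro!: tendsto_eq_intros)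
  qed
  then show ?thesis
    by (simp add: DERIV_def F_def D_def)
qed

text \<open>Divided by \<open>l\<^sup>2\<close> times the moment generating function, the entropy
  bound says that its logarithm over \<open>l\<close> has derivative at most \<open>V / 2\<close>.
  Near 0 that quotient tends to the mean.\<close>

lemma herbst:
  assumes Z: "Z \<in> bounded_measurable M" and "0 < l"
    and ent: "\<And>l. 0 < l \<Longrightarrow> expectation (\<lambda>x. l * Z x * exp (l * Z x)) -
      expectation (\<lambda>x. exp (l * Z x)) * ln (expectation (\<lambda>x. exp (l * Z x)))
      \<le> l\<^sup>2 * V / 2 * expectation (\<lambda>x. exp (l * Z x))"
  shows "expectation (\<lambda>x. exp (l * Z x)) \<le> exp (l * expectation Z + l\<^sup>2 * V / 2)"
proof -
  define F where "F l = expectation (\<lambda>x. exp (l * Z x))" for l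
  define D where "D l = expectation (\<lambda>x. Z x * exp (l * Z x))" for l
  define G where "G l = ln (F l) / l - l * V / 2" for l
  have F0: "F 0 = 1" "D 0 = expectation Z"
    by (simp_all add: F_def D_def prob_space)
  obtain B where B0: "\<forall>x\<in>space M. \<bar>Z x\<bar> \<le> B" "0 < B"
    using bounded_measurableD[OF Z] by blast
  note B = B0(1)[rule_format] B0(2)
  have Fpos: "0 < F l" for l
  proof -
    have "exp (- \<bar>l\<bar> * B) \<le> F l"
      unfolding F_def
    proof (rule integral_ge_const)
      show "integrable M (\<lambda>x. exp (l * Z x))"
        by (intro integrable_bounded_measurable bounded_measurable_intros Z)
      have "- (\<bar>l\<bar> * B) \<le> l * Z x" if "x \<in> space M" for x
      proof -
        have "\<bar>l * Z x\<bar> \<le> \<bar>l\<bar> * B"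
          unfolding abs_mult by (intro mult_left_mono B(1)[OF that]) auto
        then show ?thesis by linarith
      qed
      then show "AE x in M. exp (- \<bar>l\<bar> * B) \<le> exp (l * Z x)"
        by (intro AE_I2) simp
    qed
    then show ?thesis
      using exp_gt_zero less_le_trans by blast
  qed
  have dF: "(F has_real_derivative D l) (at l)" for l
    using has_derivative_mgf[OF Z] by (simp add: F_def[abs_def] D_def)
  have dlnF: "((\<lambda>l. ln (F l)) has_real_derivative D l / F l) (at l)" for l
    using DERIV_ln_divide[OF Fpos] dF[of l] by (auto intro!: derivative_eq_intros simp: Fpos)
  \<comment> \<open>Monotonicity stops short of 0: division by zero makes \<open>G 0 = 0\<close>,
    which need not be the limit \<open>expectation Z\<close>.\<close>
  have G_le: "G l \<le> G e" if "0 < e" "e < l" for e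
  proof (rule DERIV_nonpos_imp_nonincreasing[of e l G])
    show "e \<le> l" using that by simp
    fix x assume "e \<le> x" "x \<le> l"
    then have x: "0 < x" using that by simp
    have "(G has_real_derivative ((D x / F x * x - ln (F x)) / x\<^sup>2 - V / 2)) (at x)"
      unfolding G_def[abs_def] using x
      by (auto intro!: derivative_eq_intros dF simp: power2_eq_square Fpos)
    moreover have "(D x / F x * x - ln (F x)) / x\<^sup>2 - V / 2 \<le> 0"
    proof -
      have "expectation (\<lambda>y. x * Z y * exp (x * Z y)) = x * D x"
        unfolding D_def by (simp add: mult.assoc)
      then have "x * D x - F x * ln (F x) \<le> x\<^sup>2 * V / 2 * F x"
        using ent[OF x] by (simp add: F_def)
      then have "D x / F x * x - ln (F x) \<le> V / 2 * x\<^sup>2"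
        using Fpos[of x] by (simp add: field_simps)
      then show ?thesis
        using x by (simp add: divide_le_eq)
    qed
    ultimately show "\<exists>y. (G has_real_derivative y) (at x) \<and> y \<le> 0"
      by blast
  qed
  \<comment> \<open>As \<open>F 0 = 1\<close>, this is the difference quotient of
    \<open>ln (F l)\<close> at 0, with limit \<open>D 0 / F 0\<close>.\<close>
  have "((\<lambda>e. ln (F e) / e) \<longlongrightarrow> expectation Z) (at_right 0)"
  proof -
    have "((\<lambda>e. (ln (F (0 + e)) - ln (F 0)) / e) \<longlongrightarrow> D 0 / F 0) (at 0)"
      using dlnF[of 0] unfolding DERIV_def .
    then have "((\<lambda>e. ln (F e) / e) \<longlongrightarrow> expectation Z) (at 0)"
      by (simp add: F0)
    then show ?thesis
      by (rule tendsto_mono[OF at_le, rotated]) simp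
  qed
  then have "((\<lambda>e. G e) \<longlongrightarrow> expectation Z - 0 * V / 2) (at_right 0)"
    unfolding G_def by (intro tendsto_intros) auto
  moreover have "eventually (\<lambda>e. G l \<le> G e) (at_right 0)"
    using G_le \<open>0 < l\<close> by (auto simp: eventually_at_right_field intro!: exI[of _ l])
  ultimately have "G l \<le> expectation Z"
    using tendsto_lowerbound[of G "expectation Z" "at_right 0" "G l"] by simp
  then have "ln (F l) \<le> l * expectation Z + l\<^sup>2 * V / 2"
    using \<open>0 < l\<close> by (simp add: G_def field_simps power2_eq_square)
  then show ?thesis
    using Fpos[of l] by (metis F_def exp_le_cancel_iff exp_ln)
qed

lemma subgaussian_tail:
  assumes Z: "Z \<in> bounded_measurable M" and "0 < V" "0 \<le> t"
    and mgf: "\<And>l. 0 < l \<Longrightarrow> expectation (\<lambda>x. exp (l * Z x)) \<le> exp (l * expectation Z + l\<^sup>2 * V / 2)"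
  shows "prob {x \<in> space M. Z x - expectation Z \<ge> t} \<le> exp (- (t\<^sup>2 / (2 * V)))"
proof (cases "t = 0")
  case False
  \<comment> \<open>The minimiser of the Chernoff exponent
    \<open>l\<^sup>2 * V / 2 - l * t\<close>.\<close>
  define l where "l = t / V"
  have l: "0 < l"
    using False assms by (simp add: l_def)
  have "prob {x \<in> space M. Z x - expectation Z \<ge> t} =
    prob {x \<in> space M. exp (l * Z x) \<ge> exp (l * (t + expectation Z))}"
    using l by (intro arg_cong[where f = prob]) auto
  also have "\<dots> \<le> expectation (\<lambda>x. exp (l * Z x)) / exp (l * (t + expectation Z))"
    by (rule integral_Markov_inequality_measure[OF _ sets.top])
      (auto intro!: integrable_bounded_measurable bounded_measurable_intros Z)
  also have "\<dots> \<le> exp (l * expectation Z + l\<^sup>2 * V / 2) / exp (l * (t + expectation Z))"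
    by (intro divide_right_mono mgf l) simp
  also have "\<dots> = exp (l\<^sup>2 * V / 2 - l * t)"
    by (simp add: algebra_simps flip: exp_diff)
  also have "l\<^sup>2 * V / 2 - l * t = - (t\<^sup>2 / (2 * V))"
    using \<open>0 < V\<close> by (simp add: l_def field_simps power2_eq_square)
  finally show ?thesis .
qed simp

end

subsection \<open>Resampling coordinates in a product space\<close>

text \<open>Averaging over \<open>y\<close> gives the conditional expectation given the coordinates
  in \<open>J\<close>. Restriction to \<open>I\<close> keeps the result an extensional point of the
  product space.\<close>

definition mix :: "'i set \<Rightarrow> 'i set \<Rightarrow> ('i \<Rightarrow> 'a) \<Rightarrow> ('i \<Rightarrow> 'a) \<Rightarrow> 'i \<Rightarrow> 'a" where
  "mix I J x y = (\<lambda>i\<in>I. if i \<in> J then x i else y i)"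

lemma mix_empty: "y \<in> space (PiM I M) \<Longrightarrow> mix I {} x y = y"
  by (auto simp: mix_def space_PiM PiE_def extensional_def fun_eq_iff)

lemma mix_full: "x \<in> space (PiM I M) \<Longrightarrow> mix I I x y = x"
  by (auto simp: mix_def space_PiM PiE_def extensional_def fun_eq_iff)

lemma mix_insert_left: "j \<in> I \<Longrightarrow> j \<notin> J \<Longrightarrow> mix I (insert j J) (x(j := a)) y = mix I J x (y(j := a))"
  by (auto simp: mix_def fun_eq_iff)

lemma mix_notin_left: "j \<notin> J \<Longrightarrow> mix I J (x(j := a)) y = mix I J x y"
  by (auto simp: mix_def fun_eq_iff)

lemma measurable_mix [measurable]:
  "(\<lambda>(x, y). mix I J x y) \<in> PiM I M \<Otimes>\<^sub>M PiM I M \<rightarrow>\<^sub>M PiM I M"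
  unfolding mix_def split_beta'
  by measurable

lemma space_mix: "x \<in> space (PiM I M) \<Longrightarrow> y \<in> space (PiM I M) \<Longrightarrow> mix I J x y \<in> space (PiM I M)"
  by (auto simp: mix_def space_PiM PiE_def)

lemma measurable_coord_update [measurable]:
  assumes "k \<in> I"
  shows "(\<lambda>(x, a). x(k := a)) \<in> PiM I M \<Otimes>\<^sub>M M k \<rightarrow>\<^sub>M PiM I M"
  using measurable_add_dim[of k I M] assms by (simp add: insert_absorb)

context product_prob_space
begin

text \<open>Fubini after splitting off coordinate \<open>k\<close>: the updated point has forgotten
  its old coordinate, which integrates out because \<open>M k\<close> has mass 1.\<close>

lemma nn_integral_resample:
  assumes "finite I" "k \<in> I" and f [measurable]: "f \<in> borel_measurable (PiM I M)"
  shows "(\<integral>\<^sup>+x. f x \<partial>PiM I M) = (\<integral>\<^sup>+x. \<integral>\<^sup>+a. f (x(k := a)) \<partial>M k \<partial>PiM I M)"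
proof -
  have I: "insert k (I - {k}) = I"
    using assms by auto
  have m: "f \<in> borel_measurable (PiM (insert k (I - {k})) M)"
    using f by (simp only: I)
  have upd [measurable]: "(\<lambda>(x, a). x(k := a)) \<in> PiM I M \<Otimes>\<^sub>M M k \<rightarrow>\<^sub>M PiM I M"
    by (rule measurable_coord_update) fact
  have m2: "(\<lambda>x. \<integral>\<^sup>+a. f (x(k := a)) \<partial>M k) \<in> borel_measurable (PiM (insert k (I - {k})) M)"
    unfolding I by measurable
  have "(\<integral>\<^sup>+x. \<integral>\<^sup>+a. f (x(k := a)) \<partial>M k \<partial>PiM I M) =
    (\<integral>\<^sup>+x. \<integral>\<^sup>+b. \<integral>\<^sup>+a. f ((x(k := b))(k := a)) \<partial>M k \<partial>M k \<partial>PiM (I - {k}) M)"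
    using product_nn_integral_insert[OF _ _ m2] assms(1) unfolding I by simp
  also have "\<dots> = (\<integral>\<^sup>+x. \<integral>\<^sup>+a. f (x(k := a)) \<partial>M k \<partial>PiM (I - {k}) M)"
    by (simp add: M.emeasure_space_1)
  also have "\<dots> = (\<integral>\<^sup>+x. f x \<partial>PiM I M)"
    using product_nn_integral_insert[OF _ _ m] assms(1) unfolding I by simp
  finally show ?thesis ..
qed

text \<open>Tower property against a weight blind to coordinate \<open>j\<close>: averaging over
  that coordinate turns the conditional expectation given \<open>insert j J\<close> into the one
  given \<open>J\<close>.\<close>

lemma nn_integral_mix_insert:
  assumes "finite I" "j \<in> I" "j \<notin> J"
    and h [measurable]: "h \<in> borel_measurable (PiM I M)"
    and f [measurable]: "f \<in> borel_measurable (PiM I M)"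
    and hj: "\<And>x a. x \<in> space (PiM I M) \<Longrightarrow> a \<in> space (M j) \<Longrightarrow> h (x(j := a)) = h x"
  shows "(\<integral>\<^sup>+x. h x * (\<integral>\<^sup>+y. f (mix I (insert j J) x y) \<partial>PiM I M) \<partial>PiM I M) =
    (\<integral>\<^sup>+x. h x * (\<integral>\<^sup>+y. f (mix I J x y) \<partial>PiM I M) \<partial>PiM I M)"
proof -
  interpret PS: pair_sigma_finite "M j" "PiM I M" ..
  have upd [measurable]: "(\<lambda>(x, a). x(j := a)) \<in> PiM I M \<Otimes>\<^sub>M M j \<rightarrow>\<^sub>M PiM I M"
    by (rule measurable_coord_update) fact
  \<comment> \<open>A fresh value \<open>a\<close> at coordinate \<open>j\<close> of
    \<open>y\<close> may be regarded as coordinate \<open>j\<close> of \<open>x\<close>, once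
    \<open>j\<close> is counted among the coordinates taken from \<open>x\<close>.\<close>
  have *: "(\<integral>\<^sup>+y. f (mix I J x y) \<partial>PiM I M) = (\<integral>\<^sup>+a. \<integral>\<^sup>+y. f (mix I (insert j J) (x(j := a)) y) \<partial>PiM I M \<partial>M j)"
    if [measurable]: "x \<in> space (PiM I M)" for x
  proof -
    have "(\<integral>\<^sup>+y. f (mix I J x y) \<partial>PiM I M) = (\<integral>\<^sup>+y. \<integral>\<^sup>+a. f (mix I J x (y(j := a))) \<partial>M j \<partial>PiM I M)"
      by (rule nn_integral_resample[OF assms(1,2)]) measurable
    also have "\<dots> = (\<integral>\<^sup>+a. \<integral>\<^sup>+y. f (mix I J x (y(j := a))) \<partial>PiM I M \<partial>M j)"
      by (rule PS.Fubini') measurable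
    also have "\<dots> = (\<integral>\<^sup>+a. \<integral>\<^sup>+y. f (mix I (insert j J) (x(j := a)) y) \<partial>PiM I M \<partial>M j)"
      using assms by (simp add: mix_insert_left)
    finally show ?thesis .
  qed
  have "(\<integral>\<^sup>+x. h x * (\<integral>\<^sup>+y. f (mix I (insert j J) x y) \<partial>PiM I M) \<partial>PiM I M) =
    (\<integral>\<^sup>+x. \<integral>\<^sup>+a. h (x(j := a)) * (\<integral>\<^sup>+y. f (mix I (insert j J) (x(j := a)) y) \<partial>PiM I M) \<partial>M j \<partial>PiM I M)"
    by (rule nn_integral_resample[OF assms(1,2)]) measurable
  also have "\<dots> = (\<integral>\<^sup>+x. \<integral>\<^sup>+a. h x * (\<integral>\<^sup>+y. f (mix I (insert j J) (x(j := a)) y) \<partial>PiM I M) \<partial>M j \<partial>PiM I M)"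
    by (intro nn_integral_cong) (simp add: hj)
  also have "\<dots> = (\<integral>\<^sup>+x. h x * (\<integral>\<^sup>+y. f (mix I J x y) \<partial>PiM I M) \<partial>PiM I M)"
    by (intro nn_integral_cong, subst *, assumption, rule nn_integral_cmult) measurable
  finally show ?thesis .
qed

text \<open>Mixing two independent points preserves the law: the tower property with weight 1,
  applied one coordinate at a time.\<close>

lemma nn_integral_mix:
  assumes "finite I" "J \<subseteq> I" and f [measurable]: "f \<in> borel_measurable (PiM I M)"
  shows "(\<integral>\<^sup>+x. \<integral>\<^sup>+y. f (mix I J x y) \<partial>PiM I M \<partial>PiM I M) = (\<integral>\<^sup>+x. f x \<partial>PiM I M)"
proof -
  have "finite J"
    using assms finite_subset by blast
  then show ?thesis
    using assms(2)
  proof (induction J)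
    case empty
    have "(\<integral>\<^sup>+y. f (mix I {} x y) \<partial>PiM I M) = (\<integral>\<^sup>+y. f y \<partial>PiM I M)" for x
      by (intro nn_integral_cong) (simp add: mix_empty)
    then show ?case
      by (simp add: emeasure_space_1)
  next
    case (insert j J)
    then show ?case
      using nn_integral_mix_insert[of j J "\<lambda>_. 1" f] assms(1) by simp
  qed
qed

end

subsection \<open>Tensorization of entropy\<close>

context product_prob_space
begin

lemma bounded_measurable_integral_mix:
  assumes "f \<in> bounded_measurable (PiM I M)"
  shows "(\<lambda>x. \<integral>y. f (mix I J x y) \<partial>PiM I M) \<in> bounded_measurable (PiM I M)"
proof -
  have [measurable]: "f \<in> borel_measurable (PiM I M)"
    by (rule bounded_measurable_borel) fact
  obtain B where B: "\<forall>x\<in>space (PiM I M). \<bar>f x\<bar> \<le> B"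
    using bounded_measurableD[OF assms] by blast
  show ?thesis
  proof (rule bounded_measurableI)
    show "(\<lambda>x. \<integral>y. f (mix I J x y) \<partial>PiM I M) \<in> borel_measurable (PiM I M)"
      by measurable
    fix x assume x [measurable]: "x \<in> space (PiM I M)"
    have "\<bar>\<integral>y. f (mix I J x y) \<partial>PiM I M\<bar> \<le> (\<integral>y. \<bar>f (mix I J x y)\<bar> \<partial>PiM I M)"
      by (rule integral_abs_bound)
    also have "\<dots> \<le> B"
    proof (rule integral_le_const)
      show "integrable (PiM I M) (\<lambda>y. \<bar>f (mix I J x y)\<bar>)"
        by (rule integrable_const_bound[of _ B]) (auto simp: B x space_mix)
    qed (auto simp: B x space_mix)
    finally show "\<bar>\<integral>y. f (mix I J x y) \<partial>PiM I M\<bar> \<le> B" .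
  qed
qed

lemma bounded_measurable_mix:
  assumes "f \<in> bounded_measurable (PiM I M)" and x: "x \<in> space (PiM I M)"
  shows "(\<lambda>y. f (mix I J x y)) \<in> bounded_measurable (PiM I M)"
proof -
  have [measurable]: "f \<in> borel_measurable (PiM I M)"
    by (rule bounded_measurable_borel) fact
  obtain B where B: "\<forall>x\<in>space (PiM I M). \<bar>f x\<bar> \<le> B"
    using bounded_measurableD[OF assms(1)] by blast
  note x [measurable]
  show ?thesis
    by (rule bounded_measurableI[of _ _ B]) (auto simp: B x space_mix)
qed

text \<open>Nonnegativity makes both sides images under \<open>enn2real\<close> of nonnegative
  integrals, to which the tower property applies.\<close>

lemma integral_mix_insert:
  assumes "finite I" "j \<in> I" "j \<notin> J"
    and h: "h \<in> bounded_measurable (PiM I M)" "\<And>x. x \<in> space (PiM I M) \<Longrightarrow> 0 \<le> h x"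
    and f: "f \<in> bounded_measurable (PiM I M)" "\<And>x. x \<in> space (PiM I M) \<Longrightarrow> 0 \<le> f x"
    and hj: "\<And>x a. x \<in> space (PiM I M) \<Longrightarrow> a \<in> space (M j) \<Longrightarrow> h (x(j := a)) = h x"
  shows "(\<integral>x. h x * (\<integral>y. f (mix I (insert j J) x y) \<partial>PiM I M) \<partial>PiM I M) =
    (\<integral>x. h x * (\<integral>y. f (mix I J x y) \<partial>PiM I M) \<partial>PiM I M)"
proof -
  have [measurable]: "f \<in> borel_measurable (PiM I M)" "h \<in> borel_measurable (PiM I M)"
    using h f bounded_measurable_borel by blast+
  have eq: "(\<integral>x. h x * (\<integral>y. f (mix I K x y) \<partial>PiM I M) \<partial>PiM I M) =
    enn2real (\<integral>\<^sup>+x. ennreal (h x) * (\<integral>\<^sup>+y. ennreal (f (mix I K x y)) \<partial>PiM I M) \<partial>PiM I M)" for K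
  proof -
    have "(\<integral>x. h x * (\<integral>y. f (mix I K x y) \<partial>PiM I M) \<partial>PiM I M) =
      enn2real (\<integral>\<^sup>+x. ennreal (h x * (\<integral>y. f (mix I K x y) \<partial>PiM I M)) \<partial>PiM I M)"
    proof (rule integral_eq_nn_integral)
      show "(\<lambda>x. h x * (\<integral>y. f (mix I K x y) \<partial>PiM I M)) \<in> borel_measurable (PiM I M)"
        by measurable
      show "AE x in PiM I M. 0 \<le> h x * (\<integral>y. f (mix I K x y) \<partial>PiM I M)"
        by (intro AE_I2 mult_nonneg_nonneg integral_nonneg_AE h f space_mix)
    qed
    also have "(\<integral>\<^sup>+x. ennreal (h x * (\<integral>y. f (mix I K x y) \<partial>PiM I M)) \<partial>PiM I M) =
      (\<integral>\<^sup>+x. ennreal (h x) * (\<integral>\<^sup>+y. ennreal (f (mix I K x y)) \<partial>PiM I M) \<partial>PiM I M)"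
    proof (rule nn_integral_cong)
      fix x assume x: "x \<in> space (PiM I M)"
      have "(\<integral>\<^sup>+y. ennreal (f (mix I K x y)) \<partial>PiM I M) = ennreal (\<integral>y. f (mix I K x y) \<partial>PiM I M)"
        by (intro nn_integral_eq_integral integrable_bounded_measurable bounded_measurable_mix f x)
          (auto intro!: f space_mix x)
      then show "ennreal (h x * (\<integral>y. f (mix I K x y) \<partial>PiM I M)) =
        ennreal (h x) * (\<integral>\<^sup>+y. ennreal (f (mix I K x y)) \<partial>PiM I M)"
        using h(2)[OF x] by (simp add: ennreal_mult')
    qed
    finally show ?thesis .
  qed
  show ?thesis
    unfolding eq
    by (subst nn_integral_mix_insert[OF assms(1-3)]) (auto simp: hj)
qed

text \<open>Telescoping of \<open>ln\<close> of the partially averaged \<open>Y\<close> over the coordinates; each increment is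
  bounded pointwise by Gibbs' inequality \<open>ln r \<le> r - 1\<close>.\<close>

lemma entropy_tensorization:
  fixes a :: real
  assumes "finite I" "0 < a"
    and Y: "Y \<in> bounded_measurable (PiM I M)" "\<And>x. x \<in> space (PiM I M) \<Longrightarrow> a \<le> Y x"
    and u: "\<And>i. i \<in> I \<Longrightarrow> u i \<in> bounded_measurable (PiM I M)"
      "\<And>i x. i \<in> I \<Longrightarrow> x \<in> space (PiM I M) \<Longrightarrow> a \<le> u i x"
    and u_indep: "\<And>i x b. i \<in> I \<Longrightarrow> x \<in> space (PiM I M) \<Longrightarrow> b \<in> space (M i) \<Longrightarrow> u i (x(i := b)) = u i x"
  shows "(\<integral>x. Y x * ln (Y x) \<partial>PiM I M) - (\<integral>x. Y x \<partial>PiM I M) * ln (\<integral>x. Y x \<partial>PiM I M)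
    \<le> (\<Sum>i\<in>I. \<integral>x. Y x * ln (Y x / u i x) - Y x + u i x \<partial>PiM I M)"
proof -
  \<comment> \<open>The conditional expectation of \<open>Y\<close> given the coordinates in
    \<open>J\<close>; it runs from the constant mean at \<open>{}\<close> to \<open>Y\<close> itself
    at \<open>I\<close>.\<close>
  define A where "A J x = (\<integral>y. Y (mix I J x y) \<partial>PiM I M)" for J x
  have A_bm: "A J \<in> bounded_measurable (PiM I M)" for J
    unfolding A_def by (rule bounded_measurable_integral_mix) (rule Y)
  have A_ge: "a \<le> A J x" if x: "x \<in> space (PiM I M)" for J x
    unfolding A_def
    by (rule integral_ge_const)
      (auto intro!: integrable_bounded_measurable bounded_measurable_mix Y space_mix x)
  have A_empty: "A {} x = (\<integral>x. Y x \<partial>PiM I M)" for x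
    unfolding A_def by (rule Bochner_Integration.integral_cong) (simp_all add: mix_empty)
  have A_full: "A I x = Y x" if "x \<in> space (PiM I M)" for x
    unfolding A_def using that by (simp add: mix_full P.prob_space)
  have A_indep: "A J (x(j := b)) = A J x" if "j \<notin> J" for J j x b
    unfolding A_def using that by (simp add: mix_notin_left)
  note bm = bounded_measurable_intros bounded_measurable_ln[OF A_bm A_ge \<open>0 < a\<close>]
    bounded_measurable_ln[OF Y \<open>0 < a\<close>] Y(1) A_bm
  have step: "(\<integral>x. Y x * ln (A (insert j J) x) \<partial>PiM I M) - (\<integral>x. Y x * ln (A J x) \<partial>PiM I M)
    \<le> (\<integral>x. Y x * ln (Y x / u j x) - Y x + u j x \<partial>PiM I M)" if j: "j \<in> I" "j \<notin> J" for j J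
  proof -
    \<comment> \<open>Neither \<open>u j\<close> nor \<open>A J\<close> sees coordinate
      \<open>j\<close>. Under the integral \<open>A (insert j J)\<close> may thus be replaced by
      \<open>A J\<close>, which cancels the denominator and leaves \<open>u j\<close>.\<close>
    define h where "h x = u j x / A J x" for x
    have h: "h \<in> bounded_measurable (PiM I M)"
      unfolding h_def by (rule bounded_measurable_divide[OF u(1)[OF j(1)] A_bm A_ge \<open>0 < a\<close>])
    have lnYu: "(\<lambda>x. ln (Y x / u j x)) \<in> bounded_measurable (PiM I M)"
    proof -
      have "(\<lambda>x. ln (Y x) - ln (u j x)) \<in> bounded_measurable (PiM I M)"
        by (intro bm bounded_measurable_ln[OF u(1)[OF j(1)] u(2)[OF j(1)] \<open>0 < a\<close>])
      moreover have "ln (Y x / u j x) = ln (Y x) - ln (u j x)" if "x \<in> space (PiM I M)" for x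
        using Y(2)[OF that] u(2)[OF j(1) that] \<open>0 < a\<close> by (simp add: ln_div)
      ultimately show ?thesis
        by (simp add: bounded_measurable_def cong: measurable_cong)
    qed
    have hA: "(\<integral>x. h x * A (insert j J) x \<partial>PiM I M) = (\<integral>x. u j x \<partial>PiM I M)"
    proof -
      have "(\<integral>x. h x * A (insert j J) x \<partial>PiM I M) = (\<integral>x. h x * A J x \<partial>PiM I M)"
        unfolding A_def
      proof (rule integral_mix_insert[OF assms(1) j h _ Y(1)])
        fix x assume x: "x \<in> space (PiM I M)"
        show "0 \<le> h x" "0 \<le> Y x"
          using A_ge[OF x, of J] u(2)[OF j(1) x] Y(2)[OF x] \<open>0 < a\<close> by (auto simp: h_def)
        fix b assume "b \<in> space (M j)"
        then show "h (x(j := b)) = h x"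
          using x j by (simp add: h_def u_indep A_indep)
      qed
      also have "\<dots> = (\<integral>x. u j x \<partial>PiM I M)"
      proof (rule Bochner_Integration.integral_cong)
        fix x assume x: "x \<in> space (PiM I M)"
        show "h x * A J x = u j x"
          using A_ge[OF x, of J] \<open>0 < a\<close> by (simp add: h_def)
      qed simp
      finally show ?thesis .
    qed
    have "(\<integral>x. Y x * ln (A (insert j J) x) \<partial>PiM I M) - (\<integral>x. Y x * ln (A J x) \<partial>PiM I M) =
      (\<integral>x. Y x * ln (A (insert j J) x) - Y x * ln (A J x) \<partial>PiM I M)"
      by (rule Bochner_Integration.integral_diff[symmetric]; intro integrable_bounded_measurable bm)
    also have "\<dots> \<le> (\<integral>x. Y x * ln (Y x / u j x) - Y x + h x * A (insert j J) x \<partial>PiM I M)"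
    proof (rule integral_mono)
      show "integrable (PiM I M) (\<lambda>x. Y x * ln (A (insert j J) x) - Y x * ln (A J x))"
        by (intro integrable_bounded_measurable bm)
      show "integrable (PiM I M) (\<lambda>x. Y x * ln (Y x / u j x) - Y x + h x * A (insert j J) x)"
        by (intro integrable_bounded_measurable bm lnYu h)
      fix x assume x: "x \<in> space (PiM I M)"
      have pos: "0 < Y x" "0 < u j x" "0 < A J x" "0 < A (insert j J) x"
        using Y(2)[OF x] u(2)[OF j(1) x] A_ge[OF x, of J] A_ge[OF x, of "insert j J"] \<open>0 < a\<close> by auto
      \<comment> \<open>Chosen so that \<open>ln r\<close> is the increment of \<open>ln A\<close>
        minus \<open>ln (Y x / u j x)\<close>, while \<open>Y x * r = h x * A (insert j J) x\<close>
        has a known integral.\<close>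
      define r where "r = u j x * A (insert j J) x / (A J x * Y x)"
      have "0 < r"
        using pos by (simp add: r_def)
      have "ln r = ln (A (insert j J) x) - ln (A J x) - ln (Y x / u j x)"
        using pos by (simp add: r_def ln_div ln_mult)
      moreover have "Y x * ln r \<le> Y x * (r - 1)"
        using ln_le_minus_one[OF \<open>0 < r\<close>] pos by (intro mult_left_mono) auto
      moreover have "Y x * r = h x * A (insert j J) x"
        using pos by (simp add: r_def h_def)
      ultimately show "Y x * ln (A (insert j J) x) - Y x * ln (A J x)
        \<le> Y x * ln (Y x / u j x) - Y x + h x * A (insert j J) x"
        by (simp add: right_diff_distrib)
    qed
    also have "\<dots> = (\<integral>x. Y x * ln (Y x / u j x) - Y x \<partial>PiM I M) + (\<integral>x. h x * A (insert j J) x \<partial>PiM I M)"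
      by (rule Bochner_Integration.integral_add; intro integrable_bounded_measurable bm lnYu h)
    also have "\<dots> = (\<integral>x. Y x * ln (Y x / u j x) - Y x \<partial>PiM I M) + (\<integral>x. u j x \<partial>PiM I M)"
      by (simp only: hA)
    also have "\<dots> = (\<integral>x. Y x * ln (Y x / u j x) - Y x + u j x \<partial>PiM I M)"
      by (rule Bochner_Integration.integral_add[symmetric];
        intro integrable_bounded_measurable bm lnYu u(1) j)
    finally show ?thesis .
  qed
  have tele: "(\<integral>x. Y x * ln (A J x) \<partial>PiM I M) - (\<integral>x. Y x * ln (A {} x) \<partial>PiM I M)
    \<le> (\<Sum>i\<in>J. \<integral>x. Y x * ln (Y x / u i x) - Y x + u i x \<partial>PiM I M)"
    if "finite J" "J \<subseteq> I" for J
    using that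
  proof (induction J)
    case (insert j J)
    then show ?case
      using step[of j J] by simp
  qed simp
  have "(\<integral>x. Y x * ln (A I x) \<partial>PiM I M) = (\<integral>x. Y x * ln (Y x) \<partial>PiM I M)"
    by (rule Bochner_Integration.integral_cong) (simp_all add: A_full)
  then show ?thesis
    using tele[OF \<open>finite I\<close> subset_refl] by (simp add: A_empty)
qed

lemma mgf_bound:
  assumes "finite I"
    and Z: "Z \<in> bounded_measurable (PiM I M)"
    and g: "\<And>i. i \<in> I \<Longrightarrow> g i \<in> bounded_measurable (PiM I M)"
    and g_indep: "\<And>i x b. i \<in> I \<Longrightarrow> x \<in> space (PiM I M) \<Longrightarrow> b \<in> space (M i) \<Longrightarrow> g i (x(i := b)) = g i x"
    and g_le: "AE x in PiM I M. \<forall>i\<in>I. g i x \<le> Z x"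
    and V: "AE x in PiM I M. (\<Sum>i\<in>I. (Z x - g i x)\<^sup>2) \<le> V"
    and "0 < l"
  shows "(\<integral>x. exp (l * Z x) \<partial>PiM I M) \<le> exp (l * (\<integral>x. Z x \<partial>PiM I M) + l\<^sup>2 * V / 2)"
proof (rule herbst[OF Z \<open>0 < l\<close>])
  fix l :: real assume l: "0 < l"
  define Y where "Y x = exp (l * Z x)" for x
  define u where "u i x = exp (l * g i x)" for i x
  have bmY: "Y \<in> bounded_measurable (PiM I M)"
    unfolding Y_def by (intro bounded_measurable_intros Z)
  have bmu: "u i \<in> bounded_measurable (PiM I M)" if "i \<in> I" for i
    unfolding u_def by (intro bounded_measurable_intros g that)
  \<comment> \<open>A common bound for \<open>Z\<close> and all \<open>g i\<close> supplies the
    single positive lower bound \<open>exp (- (l * B))\<close> for \<open>Y\<close> and every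
    \<open>u i\<close> in the tensorization.\<close>
  obtain B where B: "\<forall>f\<in>insert Z (g ` I). \<forall>x\<in>space (PiM I M). \<bar>f x\<bar> \<le> B"
  proof -
    have "\<forall>f\<in>insert Z (g ` I). \<exists>B. \<forall>x\<in>space (PiM I M). \<bar>f x\<bar> \<le> B"
      using Z g by (auto simp: bounded_measurable_def)
    then obtain b where b: "\<forall>f\<in>insert Z (g ` I). \<forall>x\<in>space (PiM I M). \<bar>f x\<bar> \<le> b f"
      by metis
    show thesis
    proof (rule that[of "Max (b ` insert Z (g ` I))"], intro ballI)
      fix f x assume f: "f \<in> insert Z (g ` I)" and x: "x \<in> space (PiM I M)"
      then have "\<bar>f x\<bar> \<le> b f" using b by blast
      also have "b f \<le> Max (b ` insert Z (g ` I))"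
        using f \<open>finite I\<close> by (intro Max_ge) auto
      finally show "\<bar>f x\<bar> \<le> Max (b ` insert Z (g ` I))" .
    qed
  qed
  have lower: "- (l * B) \<le> l * f x" if "f \<in> insert Z (g ` I)" "x \<in> space (PiM I M)" for f x
  proof -
    have "- B \<le> f x" using B that by fastforce
    then have "l * - B \<le> l * f x" using l by (intro mult_left_mono) auto
    then show ?thesis by simp
  qed
  have bm: "(\<lambda>x. Y x * ln (Y x / u i x) - Y x + u i x) \<in> bounded_measurable (PiM I M)" if "i \<in> I" for i
  proof -
    have "(\<lambda>x. Y x * (l * Z x - l * g i x) - Y x + u i x) \<in> bounded_measurable (PiM I M)"
      by (intro bounded_measurable_intros bmY bmu Z g that)
    then show ?thesis
      by (simp add: Y_def u_def ln_div)
  qed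
  have "(\<integral>x. Y x * ln (Y x) \<partial>PiM I M) - (\<integral>x. Y x \<partial>PiM I M) * ln (\<integral>x. Y x \<partial>PiM I M)
    \<le> (\<Sum>i\<in>I. \<integral>x. Y x * ln (Y x / u i x) - Y x + u i x \<partial>PiM I M)"
    by (rule entropy_tensorization[OF \<open>finite I\<close> _ bmY _ bmu, of "exp (- (l * B))"])
      (auto simp: Y_def u_def g_indep intro!: lower[of Z] lower[of "g _"])
  also have "\<dots> = (\<integral>x. (\<Sum>i\<in>I. Y x * ln (Y x / u i x) - Y x + u i x) \<partial>PiM I M)"
    by (rule Bochner_Integration.integral_sum[symmetric]) (intro integrable_bounded_measurable bm)
  also have "\<dots> \<le> (\<integral>x. l\<^sup>2 * V / 2 * Y x \<partial>PiM I M)"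
  proof (rule integral_mono_AE)
    show "integrable (PiM I M) (\<lambda>x. \<Sum>i\<in>I. Y x * ln (Y x / u i x) - Y x + u i x)"
      by (intro Bochner_Integration.integrable_sum integrable_bounded_measurable bm)
    show "integrable (PiM I M) (\<lambda>x. l\<^sup>2 * V / 2 * Y x)"
      by (intro integrable_bounded_measurable bounded_measurable_intros bmY)
    show "AE x in PiM I M. (\<Sum>i\<in>I. Y x * ln (Y x / u i x) - Y x + u i x) \<le> l\<^sup>2 * V / 2 * Y x"
      using g_le V
    proof eventually_elim
      case (elim x)
      have "(\<Sum>i\<in>I. Y x * ln (Y x / u i x) - Y x + u i x) \<le> (\<Sum>i\<in>I. Y x * (l\<^sup>2 / 2 * (Z x - g i x)\<^sup>2))"
      proof (rule sum_mono)
        fix i assume i: "i \<in> I"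
        \<comment> \<open>Nonnegative because \<open>g i x \<le> Z x\<close> at this point;
          \<open>u i x\<close> becomes \<open>Y x * exp (- s)\<close>.\<close>
        define s where "s = l * (Z x - g i x)"
        have s: "0 \<le> s"
          using elim(1) i l by (simp add: s_def)
        have "ln (Y x / u i x) = s"
          by (simp add: Y_def u_def s_def ln_div right_diff_distrib)
        moreover have "u i x = Y x * exp (- s)"
          by (simp add: Y_def u_def s_def right_diff_distrib flip: exp_add)
        ultimately have "Y x * ln (Y x / u i x) - Y x + u i x = Y x * (s - 1 + exp (- s))"
          by (simp add: algebra_simps)
        also have "\<dots> \<le> Y x * (s\<^sup>2 / 2)"
          using exp_minus_le[OF s] by (intro mult_left_mono) (auto simp: Y_def)
        finally show "Y x * ln (Y x / u i x) - Y x + u i x \<le> Y x * (l\<^sup>2 / 2 * (Z x - g i x)\<^sup>2)"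
          by (simp add: s_def power_mult_distrib)
      qed
      also have "\<dots> = Y x * (l\<^sup>2 / 2) * (\<Sum>i\<in>I. (Z x - g i x)\<^sup>2)"
        by (simp add: sum_distrib_left mult.assoc)
      also have "\<dots> \<le> Y x * (l\<^sup>2 / 2) * V"
        by (intro mult_left_mono elim) (simp add: Y_def)
      finally show ?case by (simp add: algebra_simps)
    qed
  qed
  finally show "(\<integral>x. l * Z x * exp (l * Z x) \<partial>PiM I M) -
      (\<integral>x. exp (l * Z x) \<partial>PiM I M) * ln (\<integral>x. exp (l * Z x) \<partial>PiM I M)
      \<le> l\<^sup>2 * V / 2 * (\<integral>x. exp (l * Z x) \<partial>PiM I M)"
    by (simp add: Y_def mult.commute)
qed

end

subsection \<open>Almost sure boundedness\<close>

text \<open>Almost sure truth means that the integral of the indicator of failure vanishes, and this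
  integral is measurable in the parameter \<open>y\<close>.\<close>

lemma (in sigma_finite_measure) pred_AE:
  assumes [measurable]: "Measurable.pred (N \<Otimes>\<^sub>M M) (\<lambda>(y, x). R y x)"
  shows "Measurable.pred N (\<lambda>y. AE x in M. R y x)"
proof -
  have "(AE x in M. R y x) \<longleftrightarrow> (\<integral>\<^sup>+x. (if R y x then 0 else 1) \<partial>M) = 0" if [measurable]: "y \<in> space N" for y
  proof -
    have "(\<lambda>x. if R y x then 0 else 1 :: ennreal) \<in> borel_measurable M"
      by measurable
    from nn_integral_0_iff_AE[OF this] show ?thesis
      by (simp add: if_distrib cong: if_cong)
  qed
  moreover have "Measurable.pred N (\<lambda>y. (\<integral>\<^sup>+x. (if R y x then 0 else 1) \<partial>M) = 0)"
    by measurable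
  ultimately show ?thesis
    by (simp cong: measurable_cong)
qed

context product_prob_space
begin

text \<open>The failures of \<open>Q\<close> lie in a measurable null set, whose preimage under
  \<open>mix\<close> is null because mixing preserves the law.\<close>

lemma AE_mix:
  assumes "finite I" "J \<subseteq> I" and "AE x in PiM I M. Q x"
  shows "AE x in PiM I M. AE y in PiM I M. Q (mix I J x y)"
proof -
  obtain N where N: "\<And>x. x \<in> space (PiM I M) - N \<Longrightarrow> Q x" "N \<in> null_sets (PiM I M)"
    using AE_E3[OF assms(3)] by blast
  have [measurable]: "N \<in> sets (PiM I M)"
    using N(2) by auto
  have "(\<integral>\<^sup>+x. \<integral>\<^sup>+y. indicator N (mix I J x y) \<partial>PiM I M \<partial>PiM I M) = 0"
    using nn_integral_mix[OF assms(1,2), of "indicator N"] N(2) by (simp add: null_setsD1)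
  then have "AE x in PiM I M. (\<integral>\<^sup>+y. indicator N (mix I J x y) \<partial>PiM I M) = 0"
    by (subst (asm) nn_integral_0_iff_AE) simp_all
  then show ?thesis
    using AE_space
  proof eventually_elim
    case (elim x)
    note x [measurable] = elim(2)
    have "AE y in PiM I M. indicator N (mix I J x y) = (0 :: ennreal)"
      using elim(1) by (subst (asm) nn_integral_0_iff_AE) simp_all
    then show ?case
      using AE_space
    proof eventually_elim
      case (elim y)
      then show ?case
        using x by (intro N(1)) (auto simp: space_mix indicator_def split: if_splits)
    qed
  qed
qed

text \<open>The resampling formula applied to the indicator of failure of \<open>Q\<close>, which
  must be measurable to be integrated.\<close>

lemma AE_resample:
  assumes "finite I" "k \<in> I" and [measurable]: "Measurable.pred (PiM I M) Q"
    and "AE x in PiM I M. AE a in M k. Q (x(k := a))"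
  shows "AE x in PiM I M. Q x"
proof -
  have [measurable]: "(\<lambda>(x, a). x(k := a)) \<in> PiM I M \<Otimes>\<^sub>M M k \<rightarrow>\<^sub>M PiM I M"
    by (rule measurable_coord_update) fact
  define f :: "_ \<Rightarrow> ennreal" where "f x = (if Q x then 0 else 1)" for x
  have [measurable]: "f \<in> borel_measurable (PiM I M)"
    unfolding f_def by measurable
  have "AE x in PiM I M. (\<integral>\<^sup>+a. f (x(k := a)) \<partial>M k) = 0"
    using assms(4)
  proof (rule AE_mp, intro AE_I2 impI)
    fix x assume [measurable]: "x \<in> space (PiM I M)" and "AE a in M k. Q (x(k := a))"
    then have "AE a in M k. f (x(k := a)) = 0"
      by (auto simp: f_def)
    then show "(\<integral>\<^sup>+a. f (x(k := a)) \<partial>M k) = 0"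
      by (subst nn_integral_0_iff_AE) simp_all
  qed
  then have "(\<integral>\<^sup>+x. f x \<partial>PiM I M) = 0"
    unfolding nn_integral_resample[OF assms(1,2) \<open>f \<in> borel_measurable _\<close>]
    by (subst nn_integral_0_iff_AE) simp_all
  then have "AE x in PiM I M. f x = 0"
    by (subst (asm) nn_integral_0_iff_AE) simp_all
  then show ?thesis
    by (auto simp: f_def split: if_splits)
qed

text \<open>Replacing the coordinates of \<open>x\<close> one at a time by those of an independent copy \<open>y\<close> costs at most \<open>c\<close>
  per step, whence \<open>Z x \<le> Z y + card I * c\<close> almost surely.\<close>

lemma AE_bounded_if_coordinate_oscillation:
  fixes Z :: "_ \<Rightarrow> real"
  assumes "finite I" and Z [measurable]: "Z \<in> borel_measurable (PiM I M)"
    and osc: "\<And>k. k \<in> I \<Longrightarrow> AE x in PiM I M. AE a in M k. Z x \<le> Z (x(k := a)) + c"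
  shows "\<exists>B. AE x in PiM I M. \<bar>Z x\<bar> \<le> B"
proof -
  interpret PP: pair_sigma_finite "PiM I M" "PiM I M" ..
  have chain: "AE y in PiM I M. AE x in PiM I M. Z x \<le> Z (mix I J y x) + real (card J) * c"
    if "finite J" "J \<subseteq> I" for J
    using that
  proof (induction J)
    case empty
    show ?case
      by (intro AE_I2) (simp add: mix_empty)
  next
    case (insert j J)
    then have j: "j \<in> I" "j \<notin> J" "J \<subseteq> I" by auto
    have [measurable]: "(\<lambda>(x, a). x(j := a)) \<in> PiM I M \<Otimes>\<^sub>M M j \<rightarrow>\<^sub>M PiM I M"
      by (rule measurable_coord_update) fact
    define Q where "Q y x \<longleftrightarrow> Z x \<le> Z (mix I (insert j J) y x) + real (card (insert j J)) * c" for y x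
    have Q: "Measurable.pred (PiM I M \<Otimes>\<^sub>M PiM I M) (\<lambda>(y, x). Q y x)"
      unfolding Q_def by measurable
    interpret jP: pair_sigma_finite "M j" "PiM I M" ..
    have "AE y in PiM I M. AE x in PiM I M. Q y x"
    proof (rule AE_resample[OF \<open>finite I\<close> j(1)])
      show "Measurable.pred (PiM I M) (\<lambda>y. AE x in PiM I M. Q y x)"
        by (rule pred_AE) (rule Q)
      have "AE y in PiM I M. AE x in PiM I M. Z x \<le> Z (mix I J y x) + real (card J) * c"
        using insert.IH j(3) .
      \<comment> \<open>A mixture has the law of a single point, so the oscillation bound may be
        used at \<open>mix I J y x\<close>.\<close>
      moreover have "AE y in PiM I M. AE x in PiM I M. AE a in M j.
          Z (mix I J y x) \<le> Z ((mix I J y x)(j := a)) + c"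
        by (rule AE_mix[OF \<open>finite I\<close> j(3) osc[OF j(1)]])
      \<comment> \<open>With \<open>a\<close> quantified outside \<open>x\<close>, the pair of
        \<open>y\<close> and \<open>a\<close> is a resampled copy of \<open>y\<close>, which is the
        form that \<open>AE_resample\<close> absorbs.\<close>
      ultimately show "AE y in PiM I M. AE a in M j. AE x in PiM I M. Q (y(j := a)) x"
        using AE_space
      proof eventually_elim
        case (elim y)
        note [measurable] = elim(3)
        from elim(1,2) have "AE x in PiM I M. AE a in M j. Q (y(j := a)) x"
        proof eventually_elim
          case (elim x)
          note le = elim(1)
          from elim(2) show ?case
          proof eventually_elim
            case (elim a)
            moreover have "(mix I J y x)(j := a) = mix I (insert j J) (y(j := a)) x"
              using j by (auto simp: mix_def fun_eq_iff)
            moreover have "real (card (insert j J)) * c = real (card J) * c + c"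
              using insert.hyps by (simp add: distrib_right)
            ultimately show ?case
              using le unfolding Q_def by simp
          qed
        qed
        then show ?case
          by (subst jP.AE_commute) (simp_all add: Q_def)
      qed
    qed
    then show ?case
      unfolding Q_def .
  qed
  define d where "d = real (card I) * c"
  have AE1: "AE y in PiM I M. AE x in PiM I M. Z x \<le> Z y + d"
    using chain[OF \<open>finite I\<close> subset_refl] 
    by (rule AE_mp) (auto simp: mix_full d_def intro!: AE_I2)
  \<comment> \<open>A fixed \<open>y\<close> in the first form bounds \<open>Z\<close> from above; a
    fixed \<open>x\<close> in the swapped form bounds it from below.\<close>
  then have AE2: "AE x in PiM I M. AE y in PiM I M. Z x \<le> Z y + d"
    by (subst PP.AE_commute) simp_all
  obtain y where y: "AE x in PiM I M. Z x \<le> Z y + d"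
    using eventually_happens'[OF _ AE1] ae_filter_bot by blast
  obtain x where x: "AE y in PiM I M. Z x \<le> Z y + d"
    using eventually_happens'[OF _ AE2] ae_filter_bot by blast
  have "AE z in PiM I M. \<bar>Z z\<bar> \<le> \<bar>Z y + d\<bar> + \<bar>Z x - d\<bar>"
    using x y by eventually_elim linarith
  then show ?thesis by blast
qed

end

subsection \<open>Factorization and supports\<close>

text \<open>Doob-Dynkin factorization: each sublevel set of \<open>f\<close> at a rational
  \<open>q\<close> is a preimage of some \<open>B q\<close>, and \<open>f\<close> is recovered as
  the infimum of the rationals above it. Off the range of \<open>T\<close> the sets
  \<open>B q\<close> need not be nested, but \<open>g\<close> stays measurable.\<close>

lemma borel_measurable_vimage_algebra_factor:
  fixes f :: "'a \<Rightarrow> ereal"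
  assumes f: "f \<in> borel_measurable (vimage_algebra \<Omega> T N)" and T: "T \<in> \<Omega> \<rightarrow> space N"
  shows "\<exists>g\<in>borel_measurable N. \<forall>\<omega>\<in>\<Omega>. f \<omega> = g (T \<omega>)"
proof -
  have "\<exists>B\<in>sets N. {\<omega>\<in>\<Omega>. f \<omega> < ereal (real_of_rat q)} = T -` B \<inter> \<Omega>" for q
  proof -
    have "{\<omega>\<in>space (vimage_algebra \<Omega> T N). f \<omega> < ereal (real_of_rat q)} \<in> sets (vimage_algebra \<Omega> T N)"
      using f by measurable
    then show ?thesis
      by (auto simp: sets_vimage_algebra2[OF T])
  qed
  then obtain B where B: "\<And>q. B q \<in> sets N"
    "\<And>q. {\<omega>\<in>\<Omega>. f \<omega> < ereal (real_of_rat q)} = T -` B q \<inter> \<Omega>"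
    by metis
  define g where "g y = (INF q. if y \<in> B q then ereal (real_of_rat q) else \<infinity>)" for y
  have "g \<in> borel_measurable N"
    unfolding g_def using B(1) by measurable
  moreover have "f \<omega> = g (T \<omega>)" if "\<omega> \<in> \<Omega>" for \<omega>
  proof -
    have mem: "T \<omega> \<in> B q \<longleftrightarrow> f \<omega> < ereal (real_of_rat q)" for q
      using B(2)[of q] that by blast
    show ?thesis
    proof (rule antisym)
      show "f \<omega> \<le> g (T \<omega>)"
        unfolding g_def by (intro INF_greatest) (auto simp: mem)
      show "g (T \<omega>) \<le> f \<omega>"
      proof (rule dense_ge)
        fix z assume "f \<omega> < z"
        then obtain q where q: "f \<omega> < ereal (real_of_rat q)" "ereal (real_of_rat q) < z"
          using ereal_dense3 by blast
        have "g (T \<omega>) \<le> (if T \<omega> \<in> B q then ereal (real_of_rat q) else \<infinity>)"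
          unfolding g_def by (rule INF_lower) simp
        with q show "g (T \<omega>) \<le> z"
          by (simp add: mem)
      qed
    qed
  qed
  ultimately show ?thesis by blast
qed

text \<open>By second countability the complement of the support is covered by countably many null
  basis sets.\<close>

lemma AE_in_measure_support:
  fixes \<mu> :: "'a::second_countable_topology measure"
  assumes [measurable_cong]: "sets \<mu> = sets borel"
  shows "AE x in \<mu>. x \<in> measure_support \<mu>"
proof -
  obtain \<B> :: "'a set set" where \<B>: "countable \<B>" "topological_basis \<B>"
    using ex_countable_basis by blast
  have "AE x in \<mu>. x \<notin> U" if "U \<in> {U\<in>\<B>. emeasure \<mu> U = 0}" for U
  proof -
    have "U \<in> null_sets \<mu>"
      using that topological_basis_open[OF \<B>(2)] by (auto simp: null_sets_def assms)
    then show ?thesis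
      by (rule AE_not_in)
  qed
  then have "AE x in \<mu>. \<forall>U\<in>{U\<in>\<B>. emeasure \<mu> U = 0}. x \<notin> U"
    by (rule AE_ball_countable') (use \<B>(1) in auto)
  then show ?thesis
  proof eventually_elim
    case (elim x)
    show ?case
      unfolding measure_support_def
    proof (clarify)
      fix U :: "'a set" assume U: "open U" "x \<in> U"
      then obtain V where V: "V \<in> \<B>" "x \<in> V" "V \<subseteq> U"
        using topological_basisE[OF \<B>(2)] by blast
      then have "emeasure \<mu> V \<noteq> 0"
        using elim by blast
      moreover have "emeasure \<mu> V \<le> emeasure \<mu> U"
        using V(3) U(1) by (intro emeasure_mono) (auto simp: assms)
      ultimately show "0 < emeasure \<mu> U"
        by (metis gr_zeroI le_zero_eq)
    qed
  qed
qed

subsection \<open>The concentration inequality\<close>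

lemma (in prob_space) distr_restrict_indep_vars:
  assumes "indep_vars M' X I"
  shows "distr M (PiM I M') (\<lambda>\<omega>. \<lambda>i\<in>I. X i \<omega>) = PiM I (\<lambda>i. distr M (M' i) (X i))"
proof (cases "I = {}")
  \<comment> \<open>This is \<open>n = 0\<close>: both sides are the probability measure on the
    one-point space of the empty tuple.\<close>
  case True
  show ?thesis
  proof (rule measure_eqI)
    fix A assume "A \<in> sets (distr M (PiM I M') (\<lambda>\<omega>. \<lambda>i\<in>I. X i \<omega>))"
    then have "A = {} \<or> A = {\<lambda>_. undefined}"
      by (auto simp: True PiM_empty)
    then show "emeasure (distr M (PiM I M') (\<lambda>\<omega>. \<lambda>i\<in>I. X i \<omega>)) A =
        emeasure (PiM I (\<lambda>i. distr M (M' i) (X i))) A"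
      by (auto simp: True PiM_empty emeasure_distr restrict_def emeasure_space_1)
  qed (simp add: True PiM_empty)
next
  case False
  then show ?thesis
    using assms indep_vars_iff_distr_eq_PiM'[OF False, where X = X and M' = M'] by (auto simp: indep_vars_def)
qed

text \<open>Serves the variance proxy 0, where the tail bound is available with every positive
  exponent.\<close>

lemma le_zero_if_le_exp:
  fixes p :: real
  assumes "\<And>y. 0 < y \<Longrightarrow> p \<le> exp (- y)"
  shows "p \<le> 0"
proof (rule ccontr)
  assume "\<not> p \<le> 0"
  then have "exp (ln p) = p"
    by simp
  moreover have "exp (- (1 + \<bar>ln p\<bar>)) < exp (ln p)"
    unfolding exp_less_cancel_iff by linarith
  moreover have "p \<le> exp (- (1 + \<bar>ln p\<bar>))"
    by (rule assms) linarith
  ultimately show False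
    by linarith
qed

section \<open>The upper tail on the product space\<close>

context product_prob_space
begin

text \<open>The premise \<open>g_lower\<close> compares the reference at \<open>x\<close> with
  \<open>Z\<close> at a resampled point. Chained with \<open>Z x - g k x \<le> sqrt V\<close>, it
  supplies the oscillation bound that makes \<open>Z\<close> almost surely bounded.\<close>

lemma upper_tail_bound:
  assumes "finite I" and Z [measurable]: "Z \<in> borel_measurable (PiM I M)"
    and g: "\<And>i. i \<in> I \<Longrightarrow> g i \<in> borel_measurable (PiM I M)"
    and g_indep: "\<And>i x b. i \<in> I \<Longrightarrow> x \<in> space (PiM I M) \<Longrightarrow> b \<in> space (M i) \<Longrightarrow> g i (x(i := b)) = g i x"
    and g_le: "AE x in PiM I M. \<forall>i\<in>I. g i x \<le> Z x"
    and V: "AE x in PiM I M. (\<Sum>i\<in>I. (Z x - g i x)\<^sup>2) \<le> V"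
    and g_lower: "\<And>k. k \<in> I \<Longrightarrow> AE x in PiM I M. AE a in M k. g k x \<le> Z (x(k := a))"
    and "0 < V" "0 \<le> t"
  shows "measure (PiM I M) {x \<in> space (PiM I M). Z x - (\<integral>x. Z x \<partial>PiM I M) \<ge> t} \<le> exp (- (t\<^sup>2 / (2 * V)))"
proof -
  have "\<exists>B. AE x in PiM I M. \<bar>Z x\<bar> \<le> B"
  proof (rule AE_bounded_if_coordinate_oscillation[OF \<open>finite I\<close> Z])
    fix k assume k: "k \<in> I"
    show "AE x in PiM I M. AE a in M k. Z x \<le> Z (x(k := a)) + sqrt V"
      using V g_lower[OF k]
    proof eventually_elim
      case (elim x)
      have "(Z x - g k x)\<^sup>2 \<le> (\<Sum>i\<in>I. (Z x - g i x)\<^sup>2)"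
        using \<open>finite I\<close> k by (intro member_le_sum) auto
      then have "(Z x - g k x)\<^sup>2 \<le> V"
        using elim(1) by linarith
      then have le: "Z x - g k x \<le> sqrt V"
        by (rule real_le_rsqrt)
      from elim(2) show ?case
        by eventually_elim (use le in linarith)
    qed
  qed
  then obtain B where B: "AE x in PiM I M. \<bar>Z x\<bar> \<le> B" by blast
  \<comment> \<open>Clamping is monotone and 1-Lipschitz, so \<open>g i \<le> Z\<close> survives and
    \<open>(Z - g i)\<^sup>2\<close> does not grow. \<open>Z\<close> changes only on a null set,
    hence its mean and tail stay the same.\<close>
  define clamp where "clamp r = max (- \<bar>B\<bar>) (min \<bar>B\<bar> r)" for r :: real
  define Z' where "Z' x = clamp (Z x)" for x
  define g' where "g' i x = clamp (g i x)" for i x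
  have bounded: "(\<lambda>x. clamp (f x)) \<in> bounded_measurable (PiM I M)" if "f \<in> borel_measurable (PiM I M)" for f
    using that unfolding clamp_def by (intro bounded_measurableI[where B = "\<bar>B\<bar>"]) auto
  have Z': "Z' \<in> bounded_measurable (PiM I M)"
    unfolding Z'_def by (rule bounded) (rule Z)
  note [measurable] = bounded_measurable_borel[OF Z']
  have eq: "AE x in PiM I M. Z' x = Z x"
    using B by eventually_elim (auto simp: Z'_def clamp_def)
  have int_eq: "(\<integral>x. Z' x \<partial>PiM I M) = (\<integral>x. Z x \<partial>PiM I M)"
    by (rule integral_cong_AE) (use eq in measurable)
  have "measure (PiM I M) {x \<in> space (PiM I M). Z' x - (\<integral>x. Z' x \<partial>PiM I M) \<ge> t} \<le> exp (- (t\<^sup>2 / (2 * V)))"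
  proof (rule subgaussian_tail[OF Z' \<open>0 < V\<close> \<open>0 \<le> t\<close>])
    fix l :: real assume "0 < l"
    show "(\<integral>x. exp (l * Z' x) \<partial>PiM I M) \<le> exp (l * (\<integral>x. Z' x \<partial>PiM I M) + l\<^sup>2 * V / 2)"
    proof (rule mgf_bound[where g = g', OF \<open>finite I\<close> Z' _ _ _ _ \<open>0 < l\<close>])
      show "g' i \<in> bounded_measurable (PiM I M)" if "i \<in> I" for i
        unfolding g'_def by (rule bounded) (rule g[OF that])
      show "g' i (x(i := b)) = g' i x" if "i \<in> I" "x \<in> space (PiM I M)" "b \<in> space (M i)" for i x b
        using g_indep[OF that] by (simp add: g'_def)
      show "AE x in PiM I M. \<forall>i\<in>I. g' i x \<le> Z' x"
        using g_le
      proof eventually_elim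
        case (elim x)
        show ?case
        proof
          fix i assume "i \<in> I"
          then show "g' i x \<le> Z' x"
            using elim by (auto simp: g'_def Z'_def clamp_def)
        qed
      qed
      show "AE x in PiM I M. (\<Sum>i\<in>I. (Z' x - g' i x)\<^sup>2) \<le> V"
        using V
      proof eventually_elim
        case (elim x)
        have "(\<Sum>i\<in>I. (Z' x - g' i x)\<^sup>2) \<le> (\<Sum>i\<in>I. (Z x - g i x)\<^sup>2)"
        proof (rule sum_mono)
          fix i
          have "\<bar>Z' x - g' i x\<bar> \<le> \<bar>Z x - g i x\<bar>"
            unfolding g'_def Z'_def clamp_def by linarith
          then show "(Z' x - g' i x)\<^sup>2 \<le> (Z x - g i x)\<^sup>2"
            by (simp add: abs_le_square_iff)
        qed
        with elim show ?case by linarith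
      qed
    qed
  qed
  also have "measure (PiM I M) {x \<in> space (PiM I M). Z' x - (\<integral>x. Z' x \<partial>PiM I M) \<ge> t} =
    measure (PiM I M) {x \<in> space (PiM I M). Z x - (\<integral>x. Z x \<partial>PiM I M) \<ge> t}"
    unfolding int_eq
    by (rule measure_eq_AE) (use eq in \<open>auto elim: eventually_mono\<close>)
  finally show ?thesis .
qed

end

section \<open>Transfer between the sample space and the product space\<close>

lemma fun_upd_joint: "(joint n X \<omega>)(k := X k \<omega>) = joint n X \<omega>" if "k \<in> {1..n}"
  using that by (auto simp: joint_def fun_eq_iff)

lemma ereal_power2_nonneg: "0 \<le> e\<^sup>2" for e :: ereal
  by (simp add: power2_eq_square ereal_zero_le_0_iff linear)

text \<open>This is how finiteness of \<open>Delta_M_sq\<close> forces the infima to be real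
  numbers.\<close>

lemma ereal_diff_squared_lessE:
  fixes e :: ereal
  assumes "(ereal z - e)\<^sup>2 < \<infinity>"
  obtains r where "e = ereal r"
  using assms by (cases e) (auto simp: power2_eq_square)

text \<open>Both admissible kinds of \<open>S k\<close>, the image and a compact superset of the
  support, enter through the same consequence: \<open>X k \<omega> \<in> S k\<close> almost
  surely.\<close>

lemma upper_tail:
  fixes M :: "'w measure" and X :: "nat \<Rightarrow> 'w \<Rightarrow> 'a::second_countable_topology"
  assumes "prob_space M"
    and indep: "prob_space.indep_vars M (\<lambda>_. borel) X {1..n}"
    and Z: "Z \<in> borel_measurable (\<Pi>\<^sub>M i\<in>{1..n}. borel)"
    and S: "\<And>k. k \<in> {1..n} \<Longrightarrow> AE \<omega> in M. X k \<omega> \<in> S k"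
    and Zinf: "\<And>k. k \<in> {1..n} \<Longrightarrow> Z_inf n X Z S k \<in> borel_measurable (sigma_others M n X k)"
    and fin: "Linf_norm M (Delta_M_sq n X Z S) < \<infinity>" and "0 \<le> t"
  shows "ereal (measure M {\<omega> \<in> space M. Z (joint n X \<omega>) - (\<integral>\<omega>'. Z (joint n X \<omega>') \<partial>M) \<ge> t})
    \<le> exp_ereal (- (ereal (t\<^sup>2) / (2 * Linf_norm M (Delta_M_sq n X Z S))))"
proof -
  interpret prob_space M by fact
  define I where "I = {1..n}"
  have X [measurable]: "X k \<in> M \<rightarrow>\<^sub>M borel" if "k \<in> I" for k
    using indep that by (simp add: indep_vars_def I_def)
  \<comment> \<open>The constant outside \<open>I\<close> makes every \<open>N k\<close> a
    probability measure, as the product locale demands of all indices.\<close>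
  define N where "N k = distr M borel (if k \<in> I then X k else (\<lambda>_. undefined))" for k
  have sets_N [measurable_cong, simp]: "sets (N k) = sets borel" for k
    by (simp add: N_def)
  have space_N [simp]: "space (N k) = UNIV" for k
    by (simp add: N_def)
  have "prob_space (N k)" for k
    unfolding N_def by (rule prob_space_distr) simp
  then interpret N: product_prob_space N I
    by (intro product_prob_spaceI)
  have sets_P: "sets (PiM J N) = sets (PiM J (\<lambda>_. borel))" for J
    by (rule sets_PiM_cong) simp_all
  have Zm [measurable]: "Z \<in> borel_measurable (PiM I N)"
    using Z unfolding I_def[symmetric] by (simp only: measurable_cong_sets[OF sets_P refl])
  have joint [measurable]: "joint n X \<in> M \<rightarrow>\<^sub>M PiM I N"
    unfolding joint_def I_def[symmetric] by (rule measurable_restrict) simp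
  have distr_joint: "distr M (PiM I N) (joint n X) = PiM I N"
  proof -
    have "distr M (PiM I N) (joint n X) = distr M (PiM I (\<lambda>_. borel)) (\<lambda>\<omega>. \<lambda>i\<in>I. X i \<omega>)"
      by (rule distr_cong) (simp_all add: sets_P joint_def I_def)
    also have "\<dots> = PiM I (\<lambda>i. distr M borel (X i))"
      using indep unfolding I_def by (rule distr_restrict_indep_vars)
    also have "\<dots> = PiM I N"
      by (rule PiM_cong) (simp_all add: N_def)
    finally show ?thesis .
  qed
  have AE_joint: "(AE x in PiM I N. Q x) \<longleftrightarrow> (AE \<omega> in M. Q (joint n X \<omega>))"
    if [measurable]: "Measurable.pred (PiM I N) Q" for Q
    by (subst distr_joint[symmetric], subst AE_distr_iff) simp_all
  have AE_N: "(AE a in N k. Q a) \<longleftrightarrow> (AE \<omega> in M. Q (X k \<omega>))"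
    if [measurable]: "Measurable.pred borel Q" and k: "k \<in> I" for Q k
  proof -
    have "N k = distr M borel (X k)"
      using k by (simp add: N_def)
    then show ?thesis
      using X[OF k] by (simp only:) (subst AE_distr_iff, simp_all)
  qed
  have upd [measurable]: "(\<lambda>(x, a). x(k := a)) \<in> PiM I N \<Otimes>\<^sub>M borel \<rightarrow>\<^sub>M PiM I N" if "k \<in> I" for k
    using measurable_coord_update[OF that, of N] by simp

  \<comment> \<open>The infimum is measurable as a random variable over the sigma-algebra of the
    other \<open>X i\<close>; factorization turns it into a measurable function of their
    values.\<close>
  have "\<exists>h\<in>borel_measurable (PiM (I - {k}) (\<lambda>_. borel)). \<forall>\<omega>\<in>space M.
      Z_inf n X Z S k \<omega> = h (\<lambda>i\<in>I - {k}. X i \<omega>)" if "k \<in> I" for k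
    using Zinf[of k] that unfolding sigma_others_def I_def
    by (intro borel_measurable_vimage_algebra_factor) (auto simp: space_PiM)
  then obtain h where h: "\<And>k. k \<in> I \<Longrightarrow> h k \<in> borel_measurable (PiM (I - {k}) (\<lambda>_. borel))"
    "\<And>k \<omega>. k \<in> I \<Longrightarrow> \<omega> \<in> space M \<Longrightarrow> Z_inf n X Z S k \<omega> = h k (\<lambda>i\<in>I - {k}. X i \<omega>)"
    by metis
  \<comment> \<open>Restriction drops coordinate \<open>k\<close>. The default 0 of
    \<open>real_of_ereal\<close> at infinite values will concern only a null set of
    \<open>\<omega>\<close>.\<close>
  define g where "g k x = real_of_ereal (h k (restrict x (I - {k})))" for k x
  have g_meas [measurable]: "g k \<in> borel_measurable (PiM I N)" if k: "k \<in> I" for k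
  proof -
    have [measurable]: "h k \<in> borel_measurable (PiM (I - {k}) N)"
      using h(1)[OF k] by (simp only: measurable_cong_sets[OF sets_P refl])
    have [measurable]: "(\<lambda>x. restrict x (I - {k})) \<in> PiM I N \<rightarrow>\<^sub>M PiM (I - {k}) N"
      by (rule measurable_restrict_subset) auto
    show ?thesis
      unfolding g_def by measurable
  qed
  have g_indep: "g k (x(k := a)) = g k x" for k x a
    by (simp add: g_def)
  have g_joint: "real_of_ereal (Z_inf n X Z S k \<omega>) = g k (joint n X \<omega>)" if "k \<in> I" "\<omega> \<in> space M" for k \<omega>
  proof -
    have "restrict (joint n X \<omega>) (I - {k}) = (\<lambda>i\<in>I - {k}. X i \<omega>)"
      by (auto simp: joint_def I_def)
    then show ?thesis
      using h(2)[OF that] by (simp add: g_def)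
  qed

  define L where "L = Linf_norm M (Delta_M_sq n X Z S)"
  have Delta_nonneg: "0 \<le> Delta_M_sq n X Z S \<omega>" for \<omega>
    unfolding Delta_M_sq_def by (intro sum_nonneg ereal_power2_nonneg)
  have AE_L: "AE \<omega> in M. Delta_M_sq n X Z S \<omega> \<le> L"
    using esssup_AE[where M = M and f = "\<lambda>\<omega>. \<bar>Delta_M_sq n X Z S \<omega>\<bar>"] Delta_nonneg
    by (simp add: L_def Linf_norm_def)
  have "0 \<le> L"
  proof -
    obtain \<omega> where "Delta_M_sq n X Z S \<omega> \<le> L"
      using eventually_happens'[OF _ AE_L] ae_filter_bot by blast
    then show ?thesis
      using Delta_nonneg order_trans by blast
  qed
  then obtain V where V: "L = ereal V" "0 \<le> V"
    using fin by (cases L) (auto simp: L_def)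

  have real_Zinf: "AE \<omega> in M. (\<forall>k\<in>I. Z_inf n X Z S k \<omega> = ereal (g k (joint n X \<omega>))) \<and>
      (\<Sum>k\<in>I. (Z (joint n X \<omega>) - g k (joint n X \<omega>))\<^sup>2) \<le> V"
    using AE_L AE_space
  proof eventually_elim
    case (elim \<omega>)
    have eq: "Z_inf n X Z S k \<omega> = ereal (g k (joint n X \<omega>))" if k: "k \<in> I" for k
    proof -
      have "(ereal (Z (joint n X \<omega>)) - Z_inf n X Z S k \<omega>)\<^sup>2 \<le> Delta_M_sq n X Z S \<omega>"
        unfolding Delta_M_sq_def
        using sum_mono2[of "{1..n}" "{k}" "\<lambda>k. (ereal (Z (joint n X \<omega>)) - Z_inf n X Z S k \<omega>)\<^sup>2"] k
        by (simp add: I_def ereal_power2_nonneg)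
      also have "\<dots> < \<infinity>"
        using elim(1) V(1) by auto
      finally obtain r where "Z_inf n X Z S k \<omega> = ereal r"
        by (rule ereal_diff_squared_lessE)
      then show ?thesis
        using g_joint[OF k elim(2)] by simp
    qed
    have "Delta_M_sq n X Z S \<omega> = (\<Sum>k\<in>I. ereal ((Z (joint n X \<omega>) - g k (joint n X \<omega>))\<^sup>2))"
      unfolding Delta_M_sq_def by (rule sum.cong) (simp_all add: I_def eq[unfolded I_def])
    then show ?case
      using eq elim(1) V(1) by simp
  qed

  \<comment> \<open>Stated for every positive \<open>W\<close> above \<open>V\<close>, so that the
    case \<open>V = 0\<close> can let \<open>W\<close> vary.\<close>
  have tail: "measure M {\<omega> \<in> space M. Z (joint n X \<omega>) - (\<integral>\<omega>'. Z (joint n X \<omega>') \<partial>M) \<ge> t}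
    \<le> exp (- (t\<^sup>2 / (2 * W)))" if W: "0 < W" "V \<le> W" for W
  proof -
    have "measure (PiM I N) {x \<in> space (PiM I N). Z x - (\<integral>x. Z x \<partial>PiM I N) \<ge> t} \<le> exp (- (t\<^sup>2 / (2 * W)))"
    proof (rule N.upper_tail_bound[where g = g])
      show "finite I" "Z \<in> borel_measurable (PiM I N)" "0 < W" "0 \<le> t"
        using W \<open>0 \<le> t\<close> by (simp_all add: I_def[symmetric]) (simp add: I_def)
      show "g i \<in> borel_measurable (PiM I N)" if "i \<in> I" for i
        using that by (rule g_meas)
      show "g i (x(i := b)) = g i x" for i x b
        by (rule g_indep)
      have "AE \<omega> in M. \<forall>k\<in>I. X k \<omega> \<in> S k"
        using S by (intro AE_finite_allI) (auto simp: I_def)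
      with real_Zinf have "AE \<omega> in M. \<forall>i\<in>I. g i (joint n X \<omega>) \<le> Z (joint n X \<omega>)"
      proof eventually_elim
        case (elim \<omega>)
        show ?case
        proof
          fix k assume k: "k \<in> I"
          have "Z_inf n X Z S k \<omega> \<le> ereal (Z ((joint n X \<omega>)(k := X k \<omega>)))"
            unfolding Z_inf_def by (rule INF_lower) (use elim k in auto)
          then show "g k (joint n X \<omega>) \<le> Z (joint n X \<omega>)"
            using elim k fun_upd_joint[of k n X \<omega>] by (simp add: I_def)
        qed
      qed
      moreover have "Measurable.pred (PiM I N) (\<lambda>x. g i x \<le> Z x)" if "i \<in> I" for i
        unfolding pred_def by (rule borel_measurable_le[OF g_meas[OF that] Zm])
      then have "Measurable.pred (PiM I N) (\<lambda>x. \<forall>i\<in>I. g i x \<le> Z x)"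
        by (intro pred_intros_finite) (auto simp: I_def)
      ultimately show "AE x in PiM I N. \<forall>i\<in>I. g i x \<le> Z x"
        by (simp only: AE_joint)
      have "AE \<omega> in M. (\<Sum>i\<in>I. (Z (joint n X \<omega>) - g i (joint n X \<omega>))\<^sup>2) \<le> W"
        using real_Zinf by eventually_elim (use W in linarith)
      then show "AE x in PiM I N. (\<Sum>i\<in>I. (Z x - g i x)\<^sup>2) \<le> W"
        by (subst AE_joint) simp_all
      fix k assume k: "k \<in> I"
      note [measurable] = upd[OF k] g_meas[OF k]
      have meas: "Measurable.pred (PiM I N) (\<lambda>x. AE a in N k. g k x \<le> Z (x(k := a)))"
        by (rule N.M.pred_AE) measurable
      \<comment> \<open>Argued on \<open>M\<close>, not on \<open>N k\<close>: the set \<open>S k\<close>, an image, need not be measurable.\<close>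
      have "AE \<omega> in M. AE a in N k. g k (joint n X \<omega>) \<le> Z ((joint n X \<omega>)(k := a))"
        using real_Zinf AE_space
      proof eventually_elim
        case (elim \<omega>)
        note \<omega> [measurable] = measurable_space[OF joint elim(2)]
        have "AE \<omega>' in M. X k \<omega>' \<in> S k"
          using S k by (simp add: I_def)
        then have "AE \<omega>' in M. g k (joint n X \<omega>) \<le> Z ((joint n X \<omega>)(k := X k \<omega>'))"
        proof eventually_elim
          case (elim \<omega>')
          have "Z_inf n X Z S k \<omega> \<le> ereal (Z ((joint n X \<omega>)(k := X k \<omega>')))"
            unfolding Z_inf_def by (rule INF_lower) (rule elim)
          then show ?case
            using \<open>_ \<and> _\<close> k by simp
        qed
        then show ?case
          using k by (subst AE_N) simp_all
      qed
      then show "AE x in PiM I N. AE a in N k. g k x \<le> Z (x(k := a))"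
        by (subst AE_joint[OF meas])
    qed
    also have "(\<integral>x. Z x \<partial>PiM I N) = (\<integral>\<omega>. Z (joint n X \<omega>) \<partial>M)"
      by (subst distr_joint[symmetric], rule integral_distr) measurable
    also have "measure (PiM I N) {x \<in> space (PiM I N). Z x - (\<integral>\<omega>. Z (joint n X \<omega>) \<partial>M) \<ge> t} =
      measure M {\<omega> \<in> space M. Z (joint n X \<omega>) - (\<integral>\<omega>'. Z (joint n X \<omega>') \<partial>M) \<ge> t}"
    proof -
      have "measure (distr M (PiM I N) (joint n X))
          {x \<in> space (PiM I N). Z x - (\<integral>\<omega>. Z (joint n X \<omega>) \<partial>M) \<ge> t} =
        measure M (joint n X -` {x \<in> space (PiM I N). Z x - (\<integral>\<omega>. Z (joint n X \<omega>) \<partial>M) \<ge> t} \<inter> space M)"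
        by (rule measure_distr) measurable
      also have "joint n X -` {x \<in> space (PiM I N). Z x - (\<integral>\<omega>. Z (joint n X \<omega>) \<partial>M) \<ge> t} \<inter> space M =
          {\<omega> \<in> space M. Z (joint n X \<omega>) - (\<integral>\<omega>'. Z (joint n X \<omega>') \<partial>M) \<ge> t}"
        using measurable_space[OF joint] by auto
      finally show ?thesis
        by (simp only: distr_joint)
    qed
    finally show ?thesis .
  qed
  show ?thesis
  proof (cases "V = 0")
    case False
    then show ?thesis
      using tail[of V] V exp_ereal_bound_pos[of V t] by (simp add: L_def)
  next
    case True
    have "measure M {\<omega> \<in> space M. Z (joint n X \<omega>) - (\<integral>\<omega>'. Z (joint n X \<omega>') \<partial>M) \<ge> t} \<le> 0" if "t \<noteq> 0"
    proof (rule le_zero_if_le_exp)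
      fix y :: real assume "0 < y"
      \<comment> \<open>The choice of \<open>W\<close> turns the exponent
        \<open>t\<^sup>2 / (2 * W)\<close> into \<open>y\<close>.\<close>
      then show "measure M {\<omega> \<in> space M. Z (joint n X \<omega>) - (\<integral>\<omega>'. Z (joint n X \<omega>') \<partial>M) \<ge> t} \<le> exp (- y)"
        using tail[of "t\<^sup>2 / (2 * y)"] \<open>t \<noteq> 0\<close> True by simp
    qed
    then show ?thesis
      using V(1) True exp_ereal_bound_zero[of t] by (auto simp: L_def simp flip: zero_ereal_def)
  qed
qed

section \<open>Compact ranges, change of sign and the two tails\<close>

lemma AE_in_compact_range:
  fixes Y :: "'w \<Rightarrow> 'a::second_countable_topology"
  assumes [measurable]: "Y \<in> M \<rightarrow>\<^sub>M borel" and "compact_range M Y S"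
  shows "AE \<omega> in M. Y \<omega> \<in> S"
proof -
  have "AE x in distr M borel Y. x \<in> measure_support (distr M borel Y)"
    by (rule AE_in_measure_support) simp
  then have "AE \<omega> in M. Y \<omega> \<in> measure_support (distr M borel Y)"
    by (rule AE_distrD[rotated]) simp
  then show ?thesis
    by eventually_elim (use assms(2) in \<open>auto simp: compact_range_def\<close>)
qed

lemma Z_inf_uminus: "Z_inf n X (\<lambda>x. - Z x) S k \<omega> = - Z_sup n X Z S k \<omega>"
  unfolding Z_inf_def Z_sup_def by (simp add: ereal_INF_uminus_eq flip: uminus_ereal.simps)

lemma Delta_M_sq_uminus: "Delta_M_sq n X (\<lambda>x. - Z x) S = Delta_L_sq n X Z S"
proof
  fix \<omega>
  \<comment> \<open>Infinite \<open>s\<close> is covered too: both squares are then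
    \<open>\<infinity>\<close>.\<close>
  have "(ereal (- z) - - s)\<^sup>2 = (ereal z - s)\<^sup>2" for z and s :: ereal
    by (cases s) (auto simp: power2_eq_square algebra_simps)
  then show "Delta_M_sq n X (\<lambda>x. - Z x) S \<omega> = Delta_L_sq n X Z S \<omega>"
    by (simp add: Delta_M_sq_def Delta_L_sq_def Z_inf_uminus)
qed

text \<open>The measurability premises express that the extremal values are random variables
  depending only on the other \<open>X j\<close>; an infimum over an uncountable set need not be
  measurable by itself. In the first half the kind of \<open>S k\<close> may vary with
  \<open>k\<close>.\<close>

theorem theorem1:
  fixes M :: "'w measure"
    and n :: nat
    and X :: "nat \<Rightarrow> 'w \<Rightarrow> 'a::second_countable_topology"
    and Z :: "(nat \<Rightarrow> 'a) \<Rightarrow> real"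
  assumes "prob_space M"
    and "prob_space.indep_vars M (\<lambda>_. borel) X {1..n}"
    and "Z \<in> borel_measurable (\<Pi>\<^sub>M i\<in>{1..n}. borel)"
  shows
    "(\<forall>S. (\<forall>k\<in>{1..n}. S k = X k ` space M \<or> compact_range M (X k) (S k)) \<longrightarrow>
        (\<forall>k\<in>{1..n}. Z_inf n X Z S k \<in> borel_measurable (sigma_others M n X k)) \<longrightarrow>
        Linf_norm M (Delta_M_sq n X Z S) < \<infinity> \<longrightarrow>
        (\<forall>t::real. t \<ge> 0 \<longrightarrow>
           ereal (measure M {\<omega> \<in> space M.
             Z (joint n X \<omega>) - (\<integral>\<omega>'. Z (joint n X \<omega>') \<partial>M) \<ge> t})
           \<le> exp_ereal (- (ereal (t\<^sup>2) / (2 * Linf_norm M (Delta_M_sq n X Z S))))))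
     \<and>
     (\<forall>S. (\<forall>k\<in>{1..n}. compact_range M (X k) (S k)) \<longrightarrow>
        (\<forall>k\<in>{1..n}. Z_sup n X Z S k \<in> borel_measurable (sigma_others M n X k)) \<longrightarrow>
        Linf_norm M (Delta_L_sq n X Z S) < \<infinity> \<longrightarrow>
        (\<forall>t::real. t \<ge> 0 \<longrightarrow>
           ereal (measure M {\<omega> \<in> space M.
             Z (joint n X \<omega>) - (\<integral>\<omega>'. Z (joint n X \<omega>') \<partial>M) \<le> - t})
           \<le> exp_ereal (- (ereal (t\<^sup>2) / (2 * Linf_norm M (Delta_L_sq n X Z S))))))"
proof (intro conjI allI impI)
  have X: "X k \<in> M \<rightarrow>\<^sub>M borel" if "k \<in> {1..n}" for k
    using assms(2) that by (simp add: prob_space.indep_vars_def[OF assms(1)])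
  fix S and t :: real
  assume S: "\<forall>k\<in>{1..n}. S k = X k ` space M \<or> compact_range M (X k) (S k)"
    and *: "\<forall>k\<in>{1..n}. Z_inf n X Z S k \<in> borel_measurable (sigma_others M n X k)"
      "Linf_norm M (Delta_M_sq n X Z S) < \<infinity>" "0 \<le> t"
  have "AE \<omega> in M. X k \<omega> \<in> S k" if k: "k \<in> {1..n}" for k
  proof (cases "compact_range M (X k) (S k)")
    case True
    then show ?thesis
      by (rule AE_in_compact_range[OF X[OF k]])
  next
    case False
    then have "S k = X k ` space M"
      using S k by blast
    then show ?thesis
      by (intro AE_I2) simp
  qed
  then show "ereal (measure M {\<omega> \<in> space M. Z (joint n X \<omega>) - (\<integral>\<omega>'. Z (joint n X \<omega>') \<partial>M) \<ge> t})
      \<le> exp_ereal (- (ereal (t\<^sup>2) / (2 * Linf_norm M (Delta_M_sq n X Z S))))"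
    using * by (intro upper_tail[OF assms]) blast+
next
  have X: "X k \<in> M \<rightarrow>\<^sub>M borel" if "k \<in> {1..n}" for k
    using assms(2) that by (simp add: prob_space.indep_vars_def[OF assms(1)])
  fix S and t :: real
  assume S: "\<forall>k\<in>{1..n}. compact_range M (X k) (S k)"
    and Zsup: "\<forall>k\<in>{1..n}. Z_sup n X Z S k \<in> borel_measurable (sigma_others M n X k)"
    and *: "Linf_norm M (Delta_L_sq n X Z S) < \<infinity>" "0 \<le> t"
  have "ereal (measure M {\<omega> \<in> space M. - Z (joint n X \<omega>) - (\<integral>\<omega>'. - Z (joint n X \<omega>') \<partial>M) \<ge> t})
      \<le> exp_ereal (- (ereal (t\<^sup>2) / (2 * Linf_norm M (Delta_M_sq n X (\<lambda>x. - Z x) S))))"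
  proof (rule upper_tail[OF assms(1,2)])
    show "(\<lambda>x. - Z x) \<in> borel_measurable (\<Pi>\<^sub>M i\<in>{1..n}. borel)"
      using assms(3) by measurable
    fix k assume k: "k \<in> {1..n}"
    show "AE \<omega> in M. X k \<omega> \<in> S k"
      by (rule AE_in_compact_range[OF X[OF k]]) (use S k in blast)
    have [measurable]: "Z_sup n X Z S k \<in> borel_measurable (sigma_others M n X k)"
      using Zsup k by blast
    have "(\<lambda>\<omega>. - Z_sup n X Z S k \<omega>) \<in> borel_measurable (sigma_others M n X k)"
      by measurable
    then show "Z_inf n X (\<lambda>x. - Z x) S k \<in> borel_measurable (sigma_others M n X k)"
      by (simp add: Z_inf_uminus[abs_def])
  qed (use * in \<open>simp_all add: Delta_M_sq_uminus\<close>)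
  moreover have "- Z (joint n X \<omega>) - (\<integral>\<omega>'. - Z (joint n X \<omega>') \<partial>M) \<ge> t \<longleftrightarrow>
      Z (joint n X \<omega>) - (\<integral>\<omega>'. Z (joint n X \<omega>') \<partial>M) \<le> - t" for \<omega>
    by (simp, linarith)
  ultimately show "ereal (measure M {\<omega> \<in> space M. Z (joint n X \<omega>) - (\<integral>\<omega>'. Z (joint n X \<omega>') \<partial>M) \<le> - t})
      \<le> exp_ereal (- (ereal (t\<^sup>2) / (2 * Linf_norm M (Delta_L_sq n X Z S))))"
    by (simp only: Delta_M_sq_uminus)
qed

end
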